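(* Let $\mathcal{E}$ be a finite-dimensional graded-division algebra with support $K$ over a field $\mathbb{L}$, with $Z(\mathcal{E})_e=\mathbb{L}$. Suppose $\mathbb{L}$ is a finite Galois extension of a field $\mathbb{F}$ and $T$ is a group containing $K$ as a normal subgroup such that there is an isomorphism $T/K\simeq\mathrm{Gal}(\mathbb{L}/\mathbb{F})$, which we fix. Consider $\mathcal{E}$ as a $T$-graded algebra and let $\mathcal{V}$ be the direct sum of ($T$-)graded right $\mathcal{E}$-modules of rank $1$, with exactly one from each of the $[T:K]$ isomorphism classes of such modules: $\mathcal{V}=\bigoplus_{\sigma\in\mathrm{Gal}(\mathbb{L}/\mathbb{F})}\mathcal{V}_\sigma$, where the labeling is chosen so that $\mathrm{Supp}(\mathcal{V}_\sigma)$ is the coset of $K$ in $T$ corresponding to $\sigma^{-1}$ under the fixed isomorphism. Suppose that $\widetilde{\mathcal{D}}:=\mathrm{End}_{\mathcal{E}}(\mathcal{V})$ has a Galois descent datum $\mathrm{Gal}(\mathbb{L}/\mathbb{F})\to\mathrm{Aut}_{\mathbb{F}}^T(\widetilde{\mathcal{D}})$, $\sigma\mapsto\psi_\sigma$, where, for each $\sigma$, the automorphism $\psi_\sigma$ is given by a pair $(\psi_\sigma^0,\psi_\sigma^1)$, i.e., $\psi_\sigma(r)=\psi_\sigma^1\, r\,(\psi_\sigma^1)^{-1}$ for all $r\in\widetilde{\mathcal{D}}$, and where $\psi_\sigma^1(\mathcal{V}_\tau)=\mathcal{V}_{\sigma\tau}$ for all $\sigma,\tau\in\mathrm{Gal}(\mathbb{L}/\mathbb{F})$.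 Then the $\mathbb{F}$-form $\mathcal{D}$ of the graded $\mathbb{L}$-algebra $\widetilde{\mathcal{D}}$ determined by the descent, i.e., the set $\mathcal{D}=\{r\in\widetilde{\mathcal{D}}\mid\psi_\sigma(r)=r\text{ for all }\sigma\}$, is a graded-division algebra with support $T$ and $Z(\mathcal{D})_e=\mathbb{F}$. Moreover, $\mathbb{L}$ is isomorphic to a subfield of $Z(\mathcal{D}_e)$, and $\mathcal{E}\simeq\mathcal{D}_K$ as graded $\mathbb{F}$-algebras.
   Context: All algebras are associative. For a group $T$ (identity $e$), a $T$-grading on an algebra $\mathcal{A}$ is a decomposition $\mathcal{A}=\bigoplus_{t\in T}\mathcal{A}_t$ with $\mathcal{A}_s\mathcal{A}_t\subset\mathcal{A}_{st}$. The support is the set of $t$ with nonzero component in degree $t$; for $H\subset T$, $\mathcal{A}_H=\bigoplus_{t\in H}\mathcal{A}_t$. A graded-division algebra is a unital graded algebra in which every nonzero homogeneous element is invertible. $Z(\mathcal{A})_e:=Z(\mathcal{A})\cap\mathcal{A}_e$, where $Z(\mathcal{A})$ is the center. A $T$-graded right $\mathcal{E}$-module is a right module $\mathcal{V}=\bigoplus_{t\in T}\mathcal{V}_t$ with $\mathcal{V}_s\mathcal{E}_t\subset\mathcal{V}_{st}$; isomorphisms preserve degree. $\mathrm{End}_{\mathcal{E}}(\mathcal{V})$ is graded by declaring $r$ homogeneous of degree $g$ if $r(\mathcal{V}_h)\subset\mathcal{V}_{gh}$ for all $h$. Its center is identified with $Z(\mathcal{E})$, and in this way it is an $\mathbb{L}$-algebra.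 $\mathrm{Aut}_{\mathbb{F}}^T(\widetilde{\mathcal{D}})$ denotes the group of degree-preserving $\mathbb{F}$-algebra automorphisms of $\widetilde{\mathcal{D}}$. A Galois descent datum for a $T$-graded $\mathbb{L}$-algebra $\widetilde{\mathcal{A}}$ is a group homomorphism $\mathrm{Gal}(\mathbb{L}/\mathbb{F})\to\mathrm{Aut}_{\mathbb{F}}^T(\widetilde{\mathcal{A}})$, $\sigma\mapsto\psi_\sigma$, with $\psi_\sigma(x\lambda)=\psi_\sigma(x)\sigma(\lambda)$ for all $x\in\widetilde{\mathcal{A}}$, $\lambda\in\mathbb{L}$. The set $\mathcal{A}$ of common fixed points is then a graded $\mathbb{F}$-subalgebra with $\mathcal{A}\otimes_{\mathbb{F}}\mathbb{L}\to\widetilde{\mathcal{A}}$, $a\otimes\lambda\mapsto a\lambda$, an isomorphism (i.e., $\mathcal{A}$ is an $\mathbb{F}$-form of $\widetilde{\mathcal{A}}$). Known description of automorphisms: every $\psi_\sigma\in\mathrm{Aut}_{\mathbb{F}}^T(\mathrm{End}_{\mathcal{E}}(\mathcal{V}))$ is given by a pair $(\psi_\sigma^0,\psi_\sigma^1)$ where, for some $t_\sigma\in T$: $\psi_\sigma^0:\mathcal{E}\to\mathcal{E}$ is an $\mathbb{F}$-algebra automorphism with $\psi_\sigma^0(\mathcal{E}_h)=\mathcal{E}_{t_\sigma h t_\sigma^{-1}}$ for all $h\in K$; $\psi_\sigma^1:\mathcal{V}\to\mathcal{V}$ is an $\mathbb{F}$-linear bijection with $\psi_\sigma^1(vd)=\psi_\sigma^1(v)\psi_\sigma^0(d)$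 for $v\in\mathcal{V}$, $d\in\mathcal{E}$, and $\psi_\sigma^1$ maps the component of $\mathcal{V}$ of degree $h$ onto the component of degree $ht_\sigma^{-1}$ for all $h\in T$; and $\psi_\sigma(r)=\psi_\sigma^1 r(\psi_\sigma^1)^{-1}$. The pair is unique up to replacing $\psi_\sigma^1$ by $v\mapsto\psi_\sigma^1(v)d$ and $\psi_\sigma^0$ by $x\mapsto d^{-1}\psi_\sigma^0(x)d$ for a nonzero homogeneous $d\in\mathcal{E}$. One takes $\psi_{\mathrm{id}}^0=\mathrm{id}_{\mathcal{E}}$ and $\psi_{\mathrm{id}}^1=\mathrm{id}_{\mathcal{V}}$. *)

theory Defs
  imports "HOL-Algebra.Algebra"
begin

section \<open>Direct sums\<close>

definition finsupp_families :: "('a, 'm) ring_scheme \<Rightarrow> 'i set \<Rightarrow> ('i \<Rightarrow> 'a set) \<Rightarrow> ('i \<Rightarrow> 'a) set" where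
  "finsupp_families M I A = {f \<in> (\<Pi>\<^sub>E i\<in>I. A i). finite {i \<in> I. f i \<noteq> \<zero>\<^bsub>M\<^esub>}}"

definition family_sum :: "('a, 'm) ring_scheme \<Rightarrow> 'i set \<Rightarrow> ('i \<Rightarrow> 'a) \<Rightarrow> 'a" where
  "family_sum M I f = (\<Oplus>\<^bsub>M\<^esub> i\<in>{i \<in> I. f i \<noteq> \<zero>\<^bsub>M\<^esub>}. f i)"

definition internal_direct_sum :: "('a, 'm) ring_scheme \<Rightarrow> 'i set \<Rightarrow> ('i \<Rightarrow> 'a set) \<Rightarrow> bool" where
  "internal_direct_sum M I A \<longleftrightarrow>
     (\<forall>i\<in>I. additive_subgroup (A i) M) \<and>
     bij_betw (family_sum M I) (finsupp_families M I A) (carrier M)"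

text \<open>The sum of the components with index in \<open>H\<close>.\<close>

definition partial_sum :: "('a, 'm) ring_scheme \<Rightarrow> ('i \<Rightarrow> 'a set) \<Rightarrow> 'i set \<Rightarrow> 'a set" where
  "partial_sum M A H = family_sum M H ` finsupp_families M H A"

definition graded_support :: "('t, 'x) monoid_scheme \<Rightarrow> ('a, 'm) ring_scheme \<Rightarrow> ('t \<Rightarrow> 'a set) \<Rightarrow> 't set" where
  "graded_support T M A = {t \<in> carrier T. A t \<noteq> {\<zero>\<^bsub>M\<^esub>}}"


section \<open>Graded algebras\<close>

definition ring_center :: "('a, 'm) ring_scheme \<Rightarrow> 'a set" where
  "ring_center R = {z \<in> carrier R. \<forall>x\<in>carrier R. z \<otimes>\<^bsub>R\<^esub> x = x \<otimes>\<^bsub>R\<^esub> z}"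

text \<open>A unital associative algebra over a field \<open>k\<close> is a ring \<open>R\<close>, not necessarily commutative,
  with a structure map \<open>\<eta>\<close> from \<open>k\<close> to the center of \<open>R\<close>; the scalar multiple of \<open>x\<close> by \<open>c\<close> is
  \<open>x \<otimes> \<eta> c\<close>. (The library locale \<open>algebra\<close> is about commutative algebras only.)\<close>

locale unital_algebra = k?: field k + R?: ring R
  for k :: "('k, 'y) ring_scheme" and \<eta> :: "'k \<Rightarrow> 'a" and R :: "('a, 'z) ring_scheme" +
  assumes structure_map_hom: "\<eta> \<in> ring_hom k R"
    and structure_map_central: "\<eta> ` carrier k \<subseteq> ring_center R"

locale graded_algebra = T?: group T + unital_algebra k \<eta> R
  for T :: "('t, 'x) monoid_scheme"
    and k :: "('k, 'y) ring_scheme" and \<eta> :: "'k \<Rightarrow> 'a" and R :: "('a, 'z) ring_scheme"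
    and A :: "'t \<Rightarrow> 'a set" +
  assumes grading: "internal_direct_sum R (carrier T) A"
    and component_scalar: "\<lbrakk>t \<in> carrier T; x \<in> A t; c \<in> carrier k\<rbrakk> \<Longrightarrow> x \<otimes>\<^bsub>R\<^esub> \<eta> c \<in> A t"
    and component_mult:
      "\<lbrakk>s \<in> carrier T; t \<in> carrier T; x \<in> A s; y \<in> A t\<rbrakk> \<Longrightarrow> x \<otimes>\<^bsub>R\<^esub> y \<in> A (s \<otimes>\<^bsub>T\<^esub> t)"

locale graded_division_algebra = graded_algebra +
  assumes homogeneous_invertible:
    "\<lbrakk>t \<in> carrier T; x \<in> A t; x \<noteq> \<zero>\<^bsub>R\<^esub>\<rbrakk> \<Longrightarrow> x \<in> Units R"

text \<open>The group of degree-preserving algebra automorphisms, under composition.\<close>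

definition graded_aut_group ::
  "('t, 'x) monoid_scheme \<Rightarrow> ('k, 'y) ring_scheme \<Rightarrow> ('k \<Rightarrow> 'a) \<Rightarrow> ('a, 'z) ring_scheme
     \<Rightarrow> ('t \<Rightarrow> 'a set) \<Rightarrow> ('a \<Rightarrow> 'a) monoid" where
  "graded_aut_group T k \<eta> R A =
     (BijGroup (carrier R))\<lparr>carrier :=
        {f \<in> Bij (carrier R). f \<in> ring_hom R R \<and> (\<forall>c\<in>carrier k. f (\<eta> c) = \<eta> c) \<and>
           (\<forall>t\<in>carrier T. f ` A t = A t)}\<rparr>"


section \<open>Galois extensions and descent data\<close>

definition galois_group :: "('l, 'y) ring_scheme \<Rightarrow> 'l set \<Rightarrow> ('l \<Rightarrow> 'l) monoid" where
  "galois_group L F =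
     (BijGroup (carrier L))\<lparr>carrier :=
        {\<sigma> \<in> Bij (carrier L). \<sigma> \<in> ring_hom L L \<and> (\<forall>c\<in>F. \<sigma> c = c)}\<rparr>"

text \<open>Artin's definition: a finite extension is Galois if only the elements of the base field are
  fixed by all automorphisms over it.\<close>

definition finite_galois_extension :: "'l set \<Rightarrow> ('l, 'y) ring_scheme \<Rightarrow> bool" where
  "finite_galois_extension F L \<longleftrightarrow>
     field L \<and> subfield F L \<and> ring.finite_dimension L F (carrier L) \<and>
     {x \<in> carrier L. \<forall>\<sigma>\<in>carrier (galois_group L F). \<sigma> x = x} = F"

definition galois_descent_datum ::
  "('t, 'x) monoid_scheme \<Rightarrow> 'l set \<Rightarrow> ('l, 'y) ring_scheme \<Rightarrow> ('l \<Rightarrow> 'a) \<Rightarrow> ('a, 'z) ring_scheme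
     \<Rightarrow> ('t \<Rightarrow> 'a set) \<Rightarrow> (('l \<Rightarrow> 'l) \<Rightarrow> 'a \<Rightarrow> 'a) \<Rightarrow> bool" where
  "galois_descent_datum T F L \<eta> R A \<psi> \<longleftrightarrow>
     \<psi> \<in> hom (galois_group L F) (graded_aut_group T (L\<lparr>carrier := F\<rparr>) \<eta> R A) \<and>
     (\<forall>\<sigma>\<in>carrier (galois_group L F). \<forall>x\<in>carrier R. \<forall>c\<in>carrier L.
        \<psi> \<sigma> (x \<otimes>\<^bsub>R\<^esub> \<eta> c) = \<psi> \<sigma> x \<otimes>\<^bsub>R\<^esub> \<eta> (\<sigma> c))"

definition descent_form ::
  "'l set \<Rightarrow> ('l, 'y) ring_scheme \<Rightarrow> ('a, 'z) ring_scheme \<Rightarrow> (('l \<Rightarrow> 'l) \<Rightarrow> 'a \<Rightarrow> 'a)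
     \<Rightarrow> ('a, 'z) ring_scheme" where
  "descent_form F L R \<psi> =
     R\<lparr>carrier := {r \<in> carrier R. \<forall>\<sigma>\<in>carrier (galois_group L F). \<psi> \<sigma> r = r}\<rparr>"


section \<open>Graded right modules\<close>

text \<open>As in the library record \<open>module\<close>, the fields \<open>mult\<close> and \<open>one\<close> inherited from \<open>ring\<close>
  are not used.\<close>

record ('e, 'v) rmodule = "'v ring" +
  ract :: "'v \<Rightarrow> 'e \<Rightarrow> 'v" (infixl \<open>\<bullet>\<index>\<close> 70)

locale right_module = E?: ring E + M?: abelian_group M
  for E :: "('e, 'x) ring_scheme" and M :: "('e, 'v, 'y) rmodule_scheme" +
  assumes ract_closed: "\<lbrakk>v \<in> carrier M; d \<in> carrier E\<rbrakk> \<Longrightarrow> v \<bullet>\<^bsub>M\<^esub> d \<in> carrier M"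
    and ract_add_left: "\<lbrakk>v \<in> carrier M; w \<in> carrier M; d \<in> carrier E\<rbrakk> \<Longrightarrow>
      (v \<oplus>\<^bsub>M\<^esub> w) \<bullet>\<^bsub>M\<^esub> d = v \<bullet>\<^bsub>M\<^esub> d \<oplus>\<^bsub>M\<^esub> w \<bullet>\<^bsub>M\<^esub> d"
    and ract_add_right: "\<lbrakk>v \<in> carrier M; c \<in> carrier E; d \<in> carrier E\<rbrakk> \<Longrightarrow>
      v \<bullet>\<^bsub>M\<^esub> (c \<oplus>\<^bsub>E\<^esub> d) = v \<bullet>\<^bsub>M\<^esub> c \<oplus>\<^bsub>M\<^esub> v \<bullet>\<^bsub>M\<^esub> d"
    and ract_assoc: "\<lbrakk>v \<in> carrier M; c \<in> carrier E; d \<in> carrier E\<rbrakk> \<Longrightarrow>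
      v \<bullet>\<^bsub>M\<^esub> (c \<otimes>\<^bsub>E\<^esub> d) = (v \<bullet>\<^bsub>M\<^esub> c) \<bullet>\<^bsub>M\<^esub> d"
    and ract_one: "v \<in> carrier M \<Longrightarrow> v \<bullet>\<^bsub>M\<^esub> \<one>\<^bsub>E\<^esub> = v"

locale graded_right_module = T?: group T + right_module E M
  for T :: "('t, 'u) monoid_scheme"
    and E :: "('e, 'x) ring_scheme" and EE :: "'t \<Rightarrow> 'e set"
    and M :: "('e, 'v, 'y) rmodule_scheme" and MM :: "'t \<Rightarrow> 'v set" +
  assumes module_grading: "internal_direct_sum M (carrier T) MM"
    and component_ract:
      "\<lbrakk>s \<in> carrier T; t \<in> carrier T; v \<in> MM s; d \<in> EE t\<rbrakk> \<Longrightarrow> v \<bullet>\<^bsub>M\<^esub> d \<in> MM (s \<otimes>\<^bsub>T\<^esub> t)"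

text \<open>Over a graded-division algebra every graded module has a homogeneous basis, and the rank is
  its cardinality; rank \<open>1\<close> means that some single homogeneous element is a basis.\<close>

locale rank_one_graded_right_module = graded_right_module +
  assumes homogeneous_basis:
    "\<exists>t\<in>carrier T. \<exists>v\<in>MM t. bij_betw (\<lambda>d. v \<bullet>\<^bsub>M\<^esub> d) (carrier E) (carrier M)"

definition graded_module_isomorphic ::
  "('t, 'u) monoid_scheme \<Rightarrow> ('e, 'x) ring_scheme
     \<Rightarrow> ('e, 'v, 'y) rmodule_scheme \<Rightarrow> ('t \<Rightarrow> 'v set)
     \<Rightarrow> ('e, 'w, 'z) rmodule_scheme \<Rightarrow> ('t \<Rightarrow> 'w set) \<Rightarrow> bool" where
  "graded_module_isomorphic T E M MM N NN \<longleftrightarrow>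
     (\<exists>f. bij_betw f (carrier M) (carrier N) \<and>
        (\<forall>v\<in>carrier M. \<forall>w\<in>carrier M. f (v \<oplus>\<^bsub>M\<^esub> w) = f v \<oplus>\<^bsub>N\<^esub> f w) \<and>
        (\<forall>v\<in>carrier M. \<forall>d\<in>carrier E. f (v \<bullet>\<^bsub>M\<^esub> d) = f v \<bullet>\<^bsub>N\<^esub> d) \<and>
        (\<forall>t\<in>carrier T. f ` MM t = NN t))"


section \<open>The endomorphism algebra of a graded right module\<close>

definition end_ring ::
  "('e, 'x) ring_scheme \<Rightarrow> ('e, 'v, 'y) rmodule_scheme \<Rightarrow> ('v \<Rightarrow> 'v) ring" where
  "end_ring E M =
     \<lparr>carrier = {r \<in> carrier M \<rightarrow>\<^sub>E carrier M.
        (\<forall>v\<in>carrier M. \<forall>w\<in>carrier M. r (v \<oplus>\<^bsub>M\<^esub> w) = r v \<oplus>\<^bsub>M\<^esub> r w) \<and>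
        (\<forall>v\<in>carrier M. \<forall>d\<in>carrier E. r (v \<bullet>\<^bsub>M\<^esub> d) = r v \<bullet>\<^bsub>M\<^esub> d)},
      monoid.mult = (\<lambda>r s. compose (carrier M) r s),
      one = (\<lambda>v\<in>carrier M. v),
      ring.zero = (\<lambda>v\<in>carrier M. \<zero>\<^bsub>M\<^esub>),
      ring.add = (\<lambda>r s. \<lambda>v\<in>carrier M. r v \<oplus>\<^bsub>M\<^esub> s v)\<rparr>"

definition end_component ::
  "('t, 'u) monoid_scheme \<Rightarrow> ('e, 'x) ring_scheme
     \<Rightarrow> ('e, 'v, 'y) rmodule_scheme \<Rightarrow> ('t \<Rightarrow> 'v set) \<Rightarrow> 't \<Rightarrow> ('v \<Rightarrow> 'v) set" where
  "end_component T E M MM g =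
     {r \<in> carrier (end_ring E M). \<forall>h\<in>carrier T. r ` MM h \<subseteq> MM (g \<otimes>\<^bsub>T\<^esub> h)}"

text \<open>If \<open>\<eta>\<close> is the structure map of an algebra \<open>E\<close>, then the following is the structure map of
  the endomorphism algebra of \<open>M\<close>; central elements of \<open>E\<close> act on \<open>M\<close> by \<open>E\<close>-endomorphisms.\<close>

definition end_scalar :: "('l \<Rightarrow> 'e) \<Rightarrow> ('e, 'v, 'y) rmodule_scheme \<Rightarrow> 'l \<Rightarrow> 'v \<Rightarrow> 'v" where
  "end_scalar \<eta> M c = (\<lambda>v\<in>carrier M. v \<bullet>\<^bsub>M\<^esub> \<eta> c)"

text \<open>The automorphism \<open>\<psi>\<close> of the endomorphism algebra, over the field \<open>k\<close>, is given by the pair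
  \<open>(\<psi>0, \<psi>1)\<close>; \<open>K\<close> is the support of \<open>E\<close>.\<close>

definition given_by_pair ::
  "('t, 'u) monoid_scheme \<Rightarrow> 't set \<Rightarrow> ('l, 'w) ring_scheme \<Rightarrow> ('l \<Rightarrow> 'e)
     \<Rightarrow> ('e, 'x) ring_scheme \<Rightarrow> ('t \<Rightarrow> 'e set)
     \<Rightarrow> ('e, 'v, 'y) rmodule_scheme \<Rightarrow> ('t \<Rightarrow> 'v set)
     \<Rightarrow> (('v \<Rightarrow> 'v) \<Rightarrow> 'v \<Rightarrow> 'v) \<Rightarrow> ('e \<Rightarrow> 'e) \<Rightarrow> ('v \<Rightarrow> 'v) \<Rightarrow> bool" where
  "given_by_pair T K k \<eta> E EE M MM \<psi> \<psi>0 \<psi>1 \<longleftrightarrow>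
     (\<exists>t\<in>carrier T.
        \<psi>0 \<in> ring_iso E E \<and> (\<forall>c\<in>carrier k. \<psi>0 (\<eta> c) = \<eta> c) \<and>
        (\<forall>h\<in>K. \<psi>0 ` EE h = EE (t \<otimes>\<^bsub>T\<^esub> h \<otimes>\<^bsub>T\<^esub> inv\<^bsub>T\<^esub> t)) \<and>
        bij_betw \<psi>1 (carrier M) (carrier M) \<and>
        (\<forall>v\<in>carrier M. \<forall>w\<in>carrier M. \<psi>1 (v \<oplus>\<^bsub>M\<^esub> w) = \<psi>1 v \<oplus>\<^bsub>M\<^esub> \<psi>1 w) \<and>
        (\<forall>v\<in>carrier M. \<forall>c\<in>carrier k. \<psi>1 (v \<bullet>\<^bsub>M\<^esub> \<eta> c) = \<psi>1 v \<bullet>\<^bsub>M\<^esub> \<eta> c) \<and>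
        (\<forall>v\<in>carrier M. \<forall>d\<in>carrier E. \<psi>1 (v \<bullet>\<^bsub>M\<^esub> d) = \<psi>1 v \<bullet>\<^bsub>M\<^esub> \<psi>0 d) \<and>
        (\<forall>h\<in>carrier T. \<psi>1 ` MM h = MM (h \<otimes>\<^bsub>T\<^esub> inv\<^bsub>T\<^esub> t))) \<and>
     (\<forall>r\<in>carrier (end_ring E M).
        \<psi> r = compose (carrier M) \<psi>1 (compose (carrier M) r (inv_into (carrier M) \<psi>1)))"

end

(* An element of D commutes with all the maps \<psi>1 \<sigma>, which permute the summands of V transitively,
   so it is determined by its restriction to one summand, and hence by its value at one nonzero
   homogeneous vector of that summand. Conversely every value is attained, since an endomorphism
   prescribed on one summand can be averaged over the Galois group. Evaluation at a vector u of
   degree e in the summand of the identity is thus a graded bijection from D onto V, whose support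
   is all of T. Homogeneous elements of D are invertible because D moves any nonzero homogeneous
   vector to any other, and the identity r u = u d matches D_K with E. A central r of degree e has
   d central in E, so r is a scalar from L, and the scalars in D are those fixed by the group. *)

theory Submission
  imports Defs
begin

section \<open>Direct sums\<close>

text \<open>The obstacle is that \<open>\<psi>1\<close> need not be multiplicative in
  \<open>\<sigma>\<close>: a pair is determined by \<open>\<psi> \<sigma>\<close> only up to a
  homogeneous factor from \<open>E\<close>. Conjugation removes this ambiguity, so Galois translates
  of an endomorphism are indexed through the homomorphism \<open>\<psi>\<close>. A single vector
  suffices because of the interplay of two decompositions of \<open>V\<close>, by degree and by
  Galois label. The supports of the summands are the distinct cosets of \<open>K\<close>, so each
  homogeneous component lies in one summand, and every nonzero homogeneous vector is a basis of its
  summand over \<open>E\<close>. The relation \<open>r u = u d\<close> gives a homomorphism, not an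
  antihomomorphism, since \<open>r\<close> commutes with the right action of \<open>E\<close>. The
  field \<open>L\<close> occurs in two ways. As scalars \<open>v \<mapsto> v (\<eta> c)\<close> it
  lies in the center of \<open>A\<close>, and only the scalars from \<open>F\<close> survive in
  \<open>D\<close>. Through the elements of \<open>D\<close> that send \<open>u\<close> to
  \<open>u (\<eta> c)\<close> all of \<open>L\<close> embeds into degree e; these elements coincide
  with the scalars exactly for \<open>c\<close> in \<open>F\<close>.\<close>

definition additive_on ::
  "('a, 'm) ring_scheme \<Rightarrow> ('b, 'n) ring_scheme \<Rightarrow> 'a set \<Rightarrow> ('a \<Rightarrow> 'b) \<Rightarrow> bool" where
  "additive_on M N S g \<longleftrightarrow>
     g \<in> S \<rightarrow> carrier N \<and> (\<forall>x\<in>S. \<forall>y\<in>S. g (x \<oplus>\<^bsub>M\<^esub> y) = g x \<oplus>\<^bsub>N\<^esub> g y)"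

lemma additive_onI:
  assumes "\<And>x. x \<in> S \<Longrightarrow> g x \<in> carrier N"
    and "\<And>x y. x \<in> S \<Longrightarrow> y \<in> S \<Longrightarrow> g (x \<oplus>\<^bsub>M\<^esub> y) = g x \<oplus>\<^bsub>N\<^esub> g y"
  shows "additive_on M N S g"
  using assms unfolding additive_on_def by auto

lemma additive_on_closed: "additive_on M N S g \<Longrightarrow> x \<in> S \<Longrightarrow> g x \<in> carrier N"
  unfolding additive_on_def by auto

lemma additive_on_add:
  "additive_on M N S g \<Longrightarrow> x \<in> S \<Longrightarrow> y \<in> S \<Longrightarrow> g (x \<oplus>\<^bsub>M\<^esub> y) = g x \<oplus>\<^bsub>N\<^esub> g y"
  unfolding additive_on_def by auto

lemma additive_on_zero:
  assumes "abelian_group M" "abelian_group N" "additive_on M N S g" "\<zero>\<^bsub>M\<^esub> \<in> S"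
  shows "g \<zero>\<^bsub>M\<^esub> = \<zero>\<^bsub>N\<^esub>"
proof -
  interpret M: abelian_group M by fact
  interpret N: abelian_group N by fact
  have c: "g \<zero>\<^bsub>M\<^esub> \<in> carrier N"
    using additive_on_closed assms(3,4) by metis
  have "g \<zero>\<^bsub>M\<^esub> \<oplus>\<^bsub>N\<^esub> g \<zero>\<^bsub>M\<^esub> = g (\<zero>\<^bsub>M\<^esub> \<oplus>\<^bsub>M\<^esub> \<zero>\<^bsub>M\<^esub>)"
    using additive_on_add[OF assms(3,4,4)] by simp
  also have "\<dots> = g \<zero>\<^bsub>M\<^esub>" by simp
  finally have "g \<zero>\<^bsub>M\<^esub> \<oplus>\<^bsub>N\<^esub> g \<zero>\<^bsub>M\<^esub> = g \<zero>\<^bsub>M\<^esub>" .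
  then show ?thesis using c
    using N.add.r_cancel_one'[of "g \<zero>\<^bsub>M\<^esub>" "g \<zero>\<^bsub>M\<^esub>"] by auto
qed

lemma additive_on_finsum:
  assumes "abelian_group M" "abelian_group N" "additive_on M N (carrier M) g"
    and "finite S" "f \<in> S \<rightarrow> carrier M"
  shows "g (finsum M f S) = finsum N (\<lambda>i. g (f i)) S"
proof -
  interpret M: abelian_group M by fact
  interpret N: abelian_group N by fact
  show ?thesis using assms(4,5)
  proof (induction S rule: finite_induct)
    case empty
    then show ?case using additive_on_zero[OF assms(1-3)] by simp
  next
    case (insert i S)
    have "g (finsum M f (insert i S)) = g (f i \<oplus>\<^bsub>M\<^esub> finsum M f S)"
      using insert by (subst M.finsum_insert) auto
    also have "\<dots> = g (f i) \<oplus>\<^bsub>N\<^esub> g (finsum M f S)"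
      using insert by (intro additive_on_add[OF assms(3)]) auto
    also have "\<dots> = g (f i) \<oplus>\<^bsub>N\<^esub> finsum N (\<lambda>i. g (f i)) S" using insert by auto
    also have "\<dots> = finsum N (\<lambda>i. g (f i)) (insert i S)"
      using insert additive_on_closed[OF assms(3)] by (subst N.finsum_insert) (auto simp: Pi_def)
    finally show ?case .
  qed
qed

context abelian_group
begin

text \<open>Supports change under addition and under maps, so sums over different supports are
  compared over a common finite superset, where the additional terms are zero.\<close>

lemma family_sum_superset:
  assumes "S \<subseteq> I" "finite S" "{i \<in> I. f i \<noteq> \<zero>} \<subseteq> S" "f \<in> I \<rightarrow> carrier G"
  shows "family_sum G I f = finsum G f S"
  unfolding family_sum_def
proof (rule add.finprod_mono_neutral_cong_left)
  show "\<And>i. i \<in> S - {i \<in> I. f i \<noteq> \<zero>} \<Longrightarrow> f i = \<zero>" using assms by blast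
  show "f \<in> S \<rightarrow> carrier G" using assms by auto
qed (use assms in auto)

lemma finsupp_families_closed:
  assumes "internal_direct_sum G I A" "f \<in> finsupp_families G I A" "i \<in> I"
  shows "f i \<in> A i" "f i \<in> carrier G"
proof -
  show "f i \<in> A i" using assms unfolding finsupp_families_def by auto
  then show "f i \<in> carrier G"
    using assms(1,3) additive_subgroup.a_Hcarr[of "A i" G] unfolding internal_direct_sum_def by simp
qed

text \<open>Every element is a finite sum of elements of components, so a property stable under
  addition need only be checked on components. This replaces coordinates in most later
  arguments.\<close>

lemma internal_direct_sum_induct [consumes 2, case_names zero add component]:
  assumes ids: "internal_direct_sum G I A" and x: "x \<in> carrier G"
    and zero: "P \<zero>"
    and add: "\<And>x y. x \<in> carrier G \<Longrightarrow> y \<in> carrier G \<Longrightarrow> P x \<Longrightarrow> P y \<Longrightarrow> P (x \<oplus> y)"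
    and comp: "\<And>i x. i \<in> I \<Longrightarrow> x \<in> A i \<Longrightarrow> P x"
  shows "P x"
proof -
  obtain f where f: "f \<in> finsupp_families G I A" "x = family_sum G I f"
    using ids x unfolding internal_direct_sum_def bij_betw_def by blast
  have "P (finsum G f S)" if "finite S" "S \<subseteq> I" for S
    using that
  proof (induction S rule: finite_induct)
    case empty
    then show ?case using zero by simp
  next
    case (insert i S)
    note c = finsupp_families_closed[OF ids f(1)]
    have "finsum G f (insert i S) = f i \<oplus> finsum G f S"
      using insert c by (intro finsum_insert) auto
    moreover have "finsum G f S \<in> carrier G" using insert c by (intro finsum_closed) auto
    ultimately show ?case using insert c comp add by auto
  qed
  then show ?thesis using f unfolding family_sum_def finsupp_families_def by auto
qed

lemma internal_direct_sum_subgroup: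
  assumes "internal_direct_sum G I A" "i \<in> I"
  shows "A i \<subseteq> carrier G" "\<zero> \<in> A i" "\<And>x y. x \<in> A i \<Longrightarrow> y \<in> A i \<Longrightarrow> x \<oplus> y \<in> A i"
proof -
  interpret additive_subgroup "A i" G using assms unfolding internal_direct_sum_def by auto
  show "A i \<subseteq> carrier G" "\<zero> \<in> A i" "\<And>x y. x \<in> A i \<Longrightarrow> y \<in> A i \<Longrightarrow> x \<oplus> y \<in> A i"
    using a_subset by auto
qed

text \<open>The universal property of the direct sum. The index set may be infinite; each
  computation takes place over a finite set containing the supports involved.\<close>

lemma internal_direct_sum_extend:
  fixes N :: "('n, 'z) ring_scheme"
  assumes ids: "internal_direct_sum G I A" and N: "abelian_group N"
    and g: "\<And>i. i \<in> I \<Longrightarrow> additive_on G N (A i) (g i)"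
  obtains h where "additive_on G N (carrier G) h" "\<And>i x. i \<in> I \<Longrightarrow> x \<in> A i \<Longrightarrow> h x = g i x"
proof -
  interpret N: abelian_group N by fact
  note sub = internal_direct_sum_subgroup[OF ids]
  note closed = finsupp_families_closed[OF ids]
  have bij: "bij_betw (family_sum G I) (finsupp_families G I A) (carrier G)"
    using ids unfolding internal_direct_sum_def by auto
  \<comment> \<open>\<open>c x\<close> is the unique finitely supported family with sum
    \<open>x\<close>, that is, the coordinates of \<open>x\<close>.\<close>
  define c where "c = inv_into (finsupp_families G I A) (family_sum G I)"
  have c: "c x \<in> finsupp_families G I A" "family_sum G I (c x) = x" if "x \<in> carrier G" for x
    using that bij unfolding c_def bij_betw_def
    by (auto simp: inv_into_into f_inv_into_f)
  have c_eq: "c x = f" if "f \<in> finsupp_families G I A" "family_sum G I f = x" for f x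
    using that bij unfolding c_def bij_betw_def by (auto simp: inv_into_f_eq)
  define supp where "supp x = {i \<in> I. c x i \<noteq> \<zero>\<^bsub>G\<^esub>}" for x
  have fin: "finite (supp x)" if "x \<in> carrier G" for x
    using c[OF that] unfolding supp_def finsupp_families_def by auto
  have supp_I: "supp x \<subseteq> I" for x unfolding supp_def by auto
  have g0: "g i \<zero>\<^bsub>G\<^esub> = \<zero>\<^bsub>N\<^esub>" if "i \<in> I" for i
    using additive_on_zero[OF abelian_group_axioms N g[OF that] sub(2)[OF that]] .
  define h where "h x = family_sum N I (\<lambda>i. g i (c x i))" for x
  have gc: "g i (c x i) \<in> carrier N" if "i \<in> I" "x \<in> carrier G" for i x
    by (rule additive_on_closed[OF g[OF that(1)] closed(1)[OF c(1)[OF that(2)] that(1)]])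
  have h_eq: "h x = finsum N (\<lambda>i. g i (c x i)) S"
    if "x \<in> carrier G" "finite S" "supp x \<subseteq> S" "S \<subseteq> I" for x S
    unfolding h_def
  proof (rule N.family_sum_superset)
    show "{i \<in> I. g i (c x i) \<noteq> \<zero>\<^bsub>N\<^esub>} \<subseteq> S" using g0 that(3) unfolding supp_def by auto
  qed (use that gc in auto)
  have x_eq: "x = finsum G (c x) S"
    if "x \<in> carrier G" "finite S" "supp x \<subseteq> S" "S \<subseteq> I" for x S
  proof -
    have "family_sum G I (c x) = finsum G (c x) S"
      by (rule family_sum_superset) (use that closed[OF c(1)] in \<open>auto simp: supp_def\<close>)
    then show ?thesis using c(2) that by auto
  qed
  have h_closed: "h x \<in> carrier N" if "x \<in> carrier G" for x
    unfolding h_eq[OF that fin[OF that] order_refl supp_I]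
    using gc that supp_I by (intro N.finsum_closed) auto
  have h_add: "h (x \<oplus>\<^bsub>G\<^esub> y) = h x \<oplus>\<^bsub>N\<^esub> h y" if xy: "x \<in> carrier G" "y \<in> carrier G" for x y
  proof -
    define S where "S = supp x \<union> supp y"
    have S: "finite S" "supp x \<subseteq> S" "supp y \<subseteq> S" "S \<subseteq> I"
      using fin xy supp_I unfolding S_def by auto
    \<comment> \<open>The pointwise sum of the two coordinate families; uniqueness of coordinates
      will identify it with the coordinates of the sum.\<close>
    define f where "f = (\<lambda>i\<in>I. c x i \<oplus>\<^bsub>G\<^esub> c y i)"
    have f_supp: "{i \<in> I. f i \<noteq> \<zero>\<^bsub>G\<^esub>} \<subseteq> S"
      unfolding f_def S_def supp_def by auto
    have "f \<in> (\<Pi>\<^sub>E i\<in>I. A i)" unfolding f_def using closed(1)[OF c(1)] xy sub(3) by auto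
    then have fA: "f \<in> finsupp_families G I A"
      unfolding finsupp_families_def using finite_subset[OF f_supp S(1)] by simp
    have "family_sum G I f = finsum G f S"
      by (rule family_sum_superset) (use S f_supp closed[OF fA] in auto)
    also have "\<dots> = finsum G (\<lambda>i. c x i \<oplus>\<^bsub>G\<^esub> c y i) S"
      using closed[OF c(1)] xy S unfolding f_def by (intro finsum_cong') auto
    also have "\<dots> = finsum G (c x) S \<oplus>\<^bsub>G\<^esub> finsum G (c y) S"
      using closed[OF c(1)] xy S by (intro finsum_addf) auto
    also have "\<dots> = x \<oplus>\<^bsub>G\<^esub> y" using x_eq[OF xy(1) S(1,2,4)] x_eq[OF xy(2) S(1,3,4)] by simp
    finally have cf: "c (x \<oplus>\<^bsub>G\<^esub> y) = f" using c_eq[OF fA] by auto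
    have "supp (x \<oplus>\<^bsub>G\<^esub> y) \<subseteq> S" using f_supp unfolding supp_def cf .
    then have "h (x \<oplus>\<^bsub>G\<^esub> y) = finsum N (\<lambda>i. g i (f i)) S"
      using h_eq[of "x \<oplus>\<^bsub>G\<^esub> y" S] xy S cf by auto
    also have "\<dots> = finsum N (\<lambda>i. g i (c x i) \<oplus>\<^bsub>N\<^esub> g i (c y i)) S"
    proof (rule N.finsum_cong'[OF refl])
      fix i assume "i \<in> S"
      then have "i \<in> I" using S by auto
      then show "g i (f i) = g i (c x i) \<oplus>\<^bsub>N\<^esub> g i (c y i)"
        using additive_on_add[OF g] closed[OF c(1)] xy unfolding f_def by auto
    qed (use gc xy S in auto)
    also have "\<dots> = finsum N (\<lambda>i. g i (c x i)) S \<oplus>\<^bsub>N\<^esub> finsum N (\<lambda>i. g i (c y i)) S"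
      using gc xy S by (intro N.finsum_addf) auto
    also have "\<dots> = h x \<oplus>\<^bsub>N\<^esub> h y" using h_eq[OF xy(1) S(1,2,4)] h_eq[OF xy(2) S(1,3,4)] by simp
    finally show ?thesis .
  qed
  have h_comp: "h x = g i x" if i: "i \<in> I" and x: "x \<in> A i" for i x
  proof -
    have xG: "x \<in> carrier G" using sub that by auto
    \<comment> \<open>The family concentrated at \<open>i\<close> has sum \<open>x\<close>, so by
      uniqueness it is the coordinate family of \<open>x\<close>.\<close>
    define f where "f = (\<lambda>j\<in>I. if j = i then x else \<zero>\<^bsub>G\<^esub>)"
    have f_supp: "{j \<in> I. f j \<noteq> \<zero>\<^bsub>G\<^esub>} \<subseteq> {i}" unfolding f_def by auto
    have "f \<in> (\<Pi>\<^sub>E i\<in>I. A i)" unfolding f_def using x sub(2) by auto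
    then have fA: "f \<in> finsupp_families G I A"
      unfolding finsupp_families_def using finite_subset[OF f_supp] by simp
    have "family_sum G I f = finsum G f {i}"
      by (rule family_sum_superset) (use i f_supp closed[OF fA] in auto)
    also have "\<dots> = x" using i xG by (simp add: f_def)
    finally have cf: "c x = f" using c_eq[OF fA] by auto
    have "h x = finsum N (\<lambda>j. g j (f j)) {i}"
      using h_eq[of x "{i}"] xG i f_supp unfolding cf supp_def by auto
    also have "\<dots> = g i x" using i x additive_on_closed[OF g] by (simp add: f_def)
    finally show ?thesis .
  qed
  show ?thesis
    by (rule that[of h, OF additive_onI[OF h_closed h_add] h_comp])
qed

text \<open>Gluing the identity on \<open>A i\<close> with zero on the other components. Comparing
  such projections is the way in which homogeneity is proved below.\<close>

lemma internal_direct_sum_projection: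
  assumes ids: "internal_direct_sum G I A" and i: "i \<in> I"
  shows "\<exists>p. additive_on G G (carrier G) p \<and> (\<forall>x\<in>carrier G. p x \<in> A i) \<and>
    (\<forall>x\<in>A i. p x = x) \<and> (\<forall>j\<in>I. \<forall>x\<in>A j. j \<noteq> i \<longrightarrow> p x = \<zero>)"
proof -
  note sub = internal_direct_sum_subgroup[OF ids]
  define g where "g j = (if j = i then (\<lambda>x. x) else (\<lambda>x. \<zero>))" for j
  have "additive_on G G (A j) (g j)" if "j \<in> I" for j
    using sub(1)[OF that] unfolding g_def by (auto intro!: additive_onI)
  then obtain p where p: "additive_on G G (carrier G) p"
    "\<And>j x. j \<in> I \<Longrightarrow> x \<in> A j \<Longrightarrow> p x = g j x"
    using internal_direct_sum_extend[OF ids abelian_group_axioms] by blast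
  have "p x \<in> A i" if "x \<in> carrier G" for x
    using ids that
  proof (induction rule: internal_direct_sum_induct)
    case zero
    then show ?case
      using additive_on_zero[OF abelian_group_axioms abelian_group_axioms p(1)] sub(2)[OF i] by auto
  next
    case (add x y)
    then show ?case using additive_on_add[OF p(1)] sub(3)[OF i] by auto
  next
    case (component j x)
    then show ?case using p(2) sub(2)[OF i] unfolding g_def by (cases "j = i") auto
  qed
  then show ?thesis using p i unfolding g_def by auto
qed

end

text \<open>Directness is pulled back along an additive bijection. With evaluation at one vector as
  \<open>h\<close>, the grading of \<open>D\<close> comes from that of \<open>V\<close>, and no
  endomorphism has to be split into homogeneous parts by hand.\<close>

lemma internal_direct_sum_transport:
  assumes M: "abelian_group M" and N: "abelian_group N"
    and ids: "internal_direct_sum N I B"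
    and h: "additive_on M N (carrier M) h" "bij_betw h (carrier M) (carrier N)"
    and AM: "\<And>i. i \<in> I \<Longrightarrow> A i \<subseteq> carrier M"
    and hA: "\<And>i. i \<in> I \<Longrightarrow> h ` A i = B i"
  shows "internal_direct_sum M I A"
proof -
  interpret M: abelian_group M by fact
  interpret N: abelian_group N by fact
  have inj: "inj_on h (carrier M)" using h(2) unfolding bij_betw_def by auto
  interpret h: abelian_group_hom M N h
    by (rule abelian_group_homI[OF M N])
      (auto simp: group_hom_def group_hom_axioms_def M.a_group N.a_group hom_def
        additive_on_closed[OF h(1)] additive_on_add[OF h(1)])
  have A: "additive_subgroup (A i) M" if i: "i \<in> I" for i
  proof -
    interpret B: additive_subgroup "B i" N using ids i unfolding internal_direct_sum_def by auto
    have iff: "x \<in> A i \<longleftrightarrow> h x \<in> B i" if "x \<in> carrier M" for x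
      using inj_on_image_mem_iff[OF inj that AM[OF i]] hA[OF i] by simp
    have closed: "x \<in> A i \<Longrightarrow> x \<in> carrier M" for x using AM[OF i] by auto
    show ?thesis
    proof (rule additive_subgroupI, rule M.add.subgroupI)
      show "A i \<noteq> {}" using iff[OF M.zero_closed] by auto
      show "\<ominus>\<^bsub>M\<^esub> x \<in> A i" if "x \<in> A i" for x
        using that iff[of x] iff[of "\<ominus>\<^bsub>M\<^esub> x"] closed[OF that] by simp
      show "x \<oplus>\<^bsub>M\<^esub> y \<in> A i" if "x \<in> A i" "y \<in> A i" for x y
        using that iff[of x] iff[of y] iff[of "x \<oplus>\<^bsub>M\<^esub> y"] closed by simp
    qed (use AM[OF i] in simp)
  qed
  have h0: "h x = \<zero>\<^bsub>N\<^esub> \<longleftrightarrow> x = \<zero>\<^bsub>M\<^esub>" if "x \<in> carrier M" for x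
    using that additive_on_zero[OF M N h(1)] inj_on_eq_iff[OF inj that M.zero_closed] by simp
  \<comment> \<open>\<open>q\<close> pushes families forward along \<open>h\<close>. It commutes
    with taking sums and preserves supports, so bijectivity of \<open>family_sum\<close> for
    \<open>M\<close> reduces to that for \<open>N\<close>.\<close>
  define q where "q f = (\<lambda>i\<in>I. h (f i))" for f
  have fam: "q f \<in> finsupp_families N I B" "family_sum N I (q f) = h (family_sum M I f)"
    "family_sum M I f \<in> carrier M"
    if f: "f \<in> finsupp_families M I A" for f
  proof -
    have fM: "f i \<in> A i" "f i \<in> carrier M" if "i \<in> I" for i
      using f that AM unfolding finsupp_families_def by auto
    have S: "{i \<in> I. q f i \<noteq> \<zero>\<^bsub>N\<^esub>} = {i \<in> I. f i \<noteq> \<zero>\<^bsub>M\<^esub>}"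
      using h0 fM unfolding q_def by auto
    have fin: "finite {i \<in> I. f i \<noteq> \<zero>\<^bsub>M\<^esub>}" using f unfolding finsupp_families_def by auto
    have "h (f i) \<in> B i" if "i \<in> I" for i using fM(1) hA that by blast
    then have "q f \<in> (\<Pi>\<^sub>E i\<in>I. B i)" unfolding q_def by auto
    then show "q f \<in> finsupp_families N I B"
      unfolding finsupp_families_def using S fin by simp
    have "h (family_sum M I f) = finsum N (\<lambda>i. h (f i)) {i \<in> I. f i \<noteq> \<zero>\<^bsub>M\<^esub>}"
      unfolding family_sum_def using fin fM by (intro additive_on_finsum[OF M N h(1)]) auto
    also have "\<dots> = family_sum N I (q f)"
      unfolding family_sum_def S using fM additive_on_closed[OF h(1)]
      by (intro N.finsum_cong') (auto simp: q_def)
    finally show "family_sum N I (q f) = h (family_sum M I f)" by simp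
    show "family_sum M I f \<in> carrier M"
      unfolding family_sum_def using fM by (intro M.finsum_closed) auto
  qed
  have bijN: "bij_betw (family_sum N I) (finsupp_families N I B) (carrier N)"
    using ids unfolding internal_direct_sum_def by auto
  have "inj_on (family_sum M I) (finsupp_families M I A)"
  proof (rule inj_onI)
    fix f g assume f: "f \<in> finsupp_families M I A" and g: "g \<in> finsupp_families M I A"
      and "family_sum M I f = family_sum M I g"
    then have "family_sum N I (q f) = family_sum N I (q g)" using fam by simp
    then have qe: "q f = q g"
      using bijN fam(1) f g unfolding bij_betw_def inj_on_def by blast
    have "f i = g i" if "i \<in> I" for i
    proof -
      have "h (f i) = h (g i)" using fun_cong[OF qe, of i] that unfolding q_def by simp
      moreover have "f i \<in> carrier M" "g i \<in> carrier M"
        using f g that AM unfolding finsupp_families_def by auto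
      ultimately show ?thesis using inj unfolding inj_on_def by auto
    qed
    then show "f = g" using f g unfolding finsupp_families_def
      by (intro PiE_ext[of f I A g]) auto
  qed
  moreover have "family_sum M I ` finsupp_families M I A = carrier M"
  proof (intro equalityI subsetI)
    fix x assume x: "x \<in> carrier M"
    then obtain g where g: "g \<in> finsupp_families N I B" "family_sum N I g = h x"
      using bijN h(1) additive_on_closed unfolding bij_betw_def by (metis imageE)
    have "\<exists>y. y \<in> A i \<and> h y = g i" if "i \<in> I" for i
      using g(1) hA[OF that] that unfolding finsupp_families_def by (force simp: PiE_def Pi_def)
    then obtain f' where f': "\<And>i. i \<in> I \<Longrightarrow> f' i \<in> A i \<and> h (f' i) = g i" by metis
    define f where "f = restrict f' I"
    have f_supp: "{i \<in> I. f i \<noteq> \<zero>\<^bsub>M\<^esub>} \<subseteq> {i \<in> I. g i \<noteq> \<zero>\<^bsub>N\<^esub>}"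
    proof (intro subsetI CollectI conjI)
      fix i assume i: "i \<in> {i \<in> I. f i \<noteq> \<zero>\<^bsub>M\<^esub>}"
      then show "i \<in> I" by auto
      then show "g i \<noteq> \<zero>\<^bsub>N\<^esub>" using i f'[of i] h0[of "f' i"] AM[of i] unfolding f_def by auto
    qed
    have "finite {i \<in> I. g i \<noteq> \<zero>\<^bsub>N\<^esub>}" using g(1) unfolding finsupp_families_def by auto
    moreover have "f \<in> (\<Pi>\<^sub>E i\<in>I. A i)" using f' unfolding f_def by auto
    ultimately have f: "f \<in> finsupp_families M I A"
      unfolding finsupp_families_def using finite_subset[OF f_supp] by simp
    have "q f = g" using f' g(1) unfolding q_def f_def finsupp_families_def
      by (auto simp: PiE_def extensional_def)
    then have "h (family_sum M I f) = h x" using fam(2)[OF f] g(2) by simp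
    then have "family_sum M I f = x" using inj fam(3)[OF f] x unfolding inj_on_def by auto
    then show "x \<in> family_sum M I ` finsupp_families M I A" using f by auto
  qed (use fam(3) in auto)
  ultimately show ?thesis
    unfolding internal_direct_sum_def bij_betw_def using A by auto
qed


section \<open>Endomorphisms of right modules\<close>

context right_module
begin

lemma ract_zero_left: "d \<in> carrier E \<Longrightarrow> \<zero>\<^bsub>M\<^esub> \<bullet>\<^bsub>M\<^esub> d = \<zero>\<^bsub>M\<^esub>"
  using additive_on_zero[OF M.abelian_group_axioms M.abelian_group_axioms,
      of "carrier M" "\<lambda>v. v \<bullet>\<^bsub>M\<^esub> d"]
  by (auto simp: additive_on_def ract_closed ract_add_left)

lemma ract_additive: "v \<in> carrier M \<Longrightarrow> additive_on E M (carrier E) (\<lambda>d. v \<bullet>\<^bsub>M\<^esub> d)"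
  by (auto simp: additive_on_def ract_closed ract_add_right)

lemma ract_zero_right: "v \<in> carrier M \<Longrightarrow> v \<bullet>\<^bsub>M\<^esub> \<zero>\<^bsub>E\<^esub> = \<zero>\<^bsub>M\<^esub>"
  using additive_on_zero[OF E.abelian_group_axioms M.abelian_group_axioms ract_additive] by auto

lemma ract_minus_left:
  assumes "v \<in> carrier M" "d \<in> carrier E"
  shows "(\<ominus>\<^bsub>M\<^esub> v) \<bullet>\<^bsub>M\<^esub> d = \<ominus>\<^bsub>M\<^esub> (v \<bullet>\<^bsub>M\<^esub> d)"
proof -
  have "(\<ominus>\<^bsub>M\<^esub> v) \<bullet>\<^bsub>M\<^esub> d \<oplus>\<^bsub>M\<^esub> v \<bullet>\<^bsub>M\<^esub> d = \<zero>\<^bsub>M\<^esub>"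
    using assms ract_add_left[of "\<ominus>\<^bsub>M\<^esub> v" v d] by (simp add: M.l_neg ract_zero_left)
  then show ?thesis using assms by (intro M.minus_equality[symmetric]) (auto simp: ract_closed)
qed

lemma end_ringI:
  assumes "r \<in> extensional (carrier M)" "additive_on M M (carrier M) r"
    and "\<And>v d. v \<in> carrier M \<Longrightarrow> d \<in> carrier E \<Longrightarrow> r (v \<bullet>\<^bsub>M\<^esub> d) = r v \<bullet>\<^bsub>M\<^esub> d"
  shows "r \<in> carrier (end_ring E M)"
  using assms unfolding end_ring_def additive_on_def by (auto simp: PiE_def)

lemma end_ringD:
  assumes "r \<in> carrier (end_ring E M)"
  shows "r \<in> extensional (carrier M)" "additive_on M M (carrier M) r"
    and "\<And>v d. v \<in> carrier M \<Longrightarrow> d \<in> carrier E \<Longrightarrow> r (v \<bullet>\<^bsub>M\<^esub> d) = r v \<bullet>\<^bsub>M\<^esub> d"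
    and "\<And>v. v \<in> carrier M \<Longrightarrow> r v \<in> carrier M"
  using assms unfolding end_ring_def additive_on_def by (auto simp: PiE_def)

lemma end_ring_eqI:
  assumes "r \<in> carrier (end_ring E M)" "s \<in> carrier (end_ring E M)"
    and "\<And>v. v \<in> carrier M \<Longrightarrow> r v = s v"
  shows "r = s"
  using assms extensionalityI[OF end_ringD(1) end_ringD(1)] by blast

lemma end_ring_add: "v \<in> carrier M \<Longrightarrow> (r \<oplus>\<^bsub>end_ring E M\<^esub> s) v = r v \<oplus>\<^bsub>M\<^esub> s v"
  by (simp add: end_ring_def)

lemma end_ring_mult: "v \<in> carrier M \<Longrightarrow> (r \<otimes>\<^bsub>end_ring E M\<^esub> s) v = r (s v)"
  by (simp add: end_ring_def compose_def)

lemma end_ring_one: "v \<in> carrier M \<Longrightarrow> \<one>\<^bsub>end_ring E M\<^esub> v = v"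
  by (simp add: end_ring_def)

lemma end_ring_zero: "v \<in> carrier M \<Longrightarrow> \<zero>\<^bsub>end_ring E M\<^esub> v = \<zero>\<^bsub>M\<^esub>"
  by (simp add: end_ring_def)

lemmas end_ring_apply = end_ring_add end_ring_mult end_ring_one end_ring_zero

lemma end_ring_add_closed:
  assumes r: "r \<in> carrier (end_ring E M)" and s: "s \<in> carrier (end_ring E M)"
  shows "r \<oplus>\<^bsub>end_ring E M\<^esub> s \<in> carrier (end_ring E M)"
proof (rule end_ringI)
  show "r \<oplus>\<^bsub>end_ring E M\<^esub> s \<in> extensional (carrier M)" by (simp add: end_ring_def)
  note r = end_ringD[OF r] and s = end_ringD[OF s]
  show "additive_on M M (carrier M) (r \<oplus>\<^bsub>end_ring E M\<^esub> s)"
    by (rule additive_onI)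
      (simp_all add: end_ring_add r(4) s(4) additive_on_add[OF r(2)] additive_on_add[OF s(2)] M.a_ac)
  show "(r \<oplus>\<^bsub>end_ring E M\<^esub> s) (v \<bullet>\<^bsub>M\<^esub> d) = (r \<oplus>\<^bsub>end_ring E M\<^esub> s) v \<bullet>\<^bsub>M\<^esub> d"
    if "v \<in> carrier M" "d \<in> carrier E" for v d
    using that r(3,4) s(3,4) by (simp add: end_ring_add ract_closed ract_add_left)
qed

lemma end_ring_mult_closed:
  assumes r: "r \<in> carrier (end_ring E M)" and s: "s \<in> carrier (end_ring E M)"
  shows "r \<otimes>\<^bsub>end_ring E M\<^esub> s \<in> carrier (end_ring E M)"
proof (rule end_ringI)
  show "r \<otimes>\<^bsub>end_ring E M\<^esub> s \<in> extensional (carrier M)"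
    by (simp add: end_ring_def compose_extensional)
  note r = end_ringD[OF r] and s = end_ringD[OF s]
  show "additive_on M M (carrier M) (r \<otimes>\<^bsub>end_ring E M\<^esub> s)"
    by (rule additive_onI)
      (simp_all add: end_ring_mult r(4) s(4) additive_on_add[OF r(2)] additive_on_add[OF s(2)])
  show "(r \<otimes>\<^bsub>end_ring E M\<^esub> s) (v \<bullet>\<^bsub>M\<^esub> d) = (r \<otimes>\<^bsub>end_ring E M\<^esub> s) v \<bullet>\<^bsub>M\<^esub> d"
    if "v \<in> carrier M" "d \<in> carrier E" for v d
    using that r(3,4) s(3,4) by (simp add: end_ring_mult ract_closed)
qed

lemma end_ring_one_closed: "\<one>\<^bsub>end_ring E M\<^esub> \<in> carrier (end_ring E M)"
  by (rule end_ringI) (auto simp: end_ring_def additive_on_def ract_closed)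

lemma end_ring_zero_closed: "\<zero>\<^bsub>end_ring E M\<^esub> \<in> carrier (end_ring E M)"
  by (rule end_ringI) (auto simp: end_ring_def additive_on_def ract_closed ract_zero_left)

lemma end_ring_minus_closed:
  assumes r: "r \<in> carrier (end_ring E M)"
  shows "(\<lambda>v\<in>carrier M. \<ominus>\<^bsub>M\<^esub> r v) \<in> carrier (end_ring E M)"
proof (rule end_ringI)
  note r = end_ringD[OF r]
  show "additive_on M M (carrier M) (\<lambda>v\<in>carrier M. \<ominus>\<^bsub>M\<^esub> r v)"
    by (rule additive_onI) (simp_all add: r(4) additive_on_add[OF r(2)] M.minus_add)
  show "(\<lambda>v\<in>carrier M. \<ominus>\<^bsub>M\<^esub> r v) (v \<bullet>\<^bsub>M\<^esub> d) = (\<lambda>v\<in>carrier M. \<ominus>\<^bsub>M\<^esub> r v) v \<bullet>\<^bsub>M\<^esub> d"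
    if "v \<in> carrier M" "d \<in> carrier E" for v d
    using that r(3,4) by (simp add: ract_closed ract_minus_left)
qed simp

lemmas end_ring_closed =
  end_ring_add_closed end_ring_mult_closed end_ring_one_closed end_ring_zero_closed

text \<open>Endomorphisms are extensional functions, so each ring law is a pointwise identity in
  \<open>M\<close>; the law \<open>t (r + s) = t r + t s\<close> is where additivity of
  \<open>t\<close> enters.\<close>

lemma ring_end_ring: "ring (end_ring E M)"
proof (rule ringI)
  let ?A = "end_ring E M"
  note app = end_ring_apply end_ringD(4)
  show "abelian_group ?A"
  proof (rule abelian_groupI)
    fix r assume r: "r \<in> carrier ?A"
    show "\<exists>s\<in>carrier ?A. s \<oplus>\<^bsub>?A\<^esub> r = \<zero>\<^bsub>?A\<^esub>"
      by (rule bexI[OF _ end_ring_minus_closed[OF r]], rule end_ring_eqI)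
        (use r in \<open>simp_all add: end_ring_closed end_ring_minus_closed app M.l_neg\<close>)
  qed (auto intro!: end_ring_eqI simp: end_ring_closed app M.a_ac)
  show "monoid ?A"
    by (rule monoidI) (auto intro!: end_ring_eqI simp: end_ring_closed app)
  show "(r \<oplus>\<^bsub>?A\<^esub> s) \<otimes>\<^bsub>?A\<^esub> t = r \<otimes>\<^bsub>?A\<^esub> t \<oplus>\<^bsub>?A\<^esub> s \<otimes>\<^bsub>?A\<^esub> t"
    if "r \<in> carrier ?A" "s \<in> carrier ?A" "t \<in> carrier ?A" for r s t
    by (rule end_ring_eqI) (use that in \<open>simp_all add: end_ring_closed app\<close>)
  show "t \<otimes>\<^bsub>?A\<^esub> (r \<oplus>\<^bsub>?A\<^esub> s) = t \<otimes>\<^bsub>?A\<^esub> r \<oplus>\<^bsub>?A\<^esub> t \<otimes>\<^bsub>?A\<^esub> s"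
    if "r \<in> carrier ?A" "s \<in> carrier ?A" "t \<in> carrier ?A" for r s t
    by (rule end_ring_eqI)
      (use that additive_on_add[OF end_ringD(2)] in \<open>simp_all add: end_ring_closed app\<close>)
qed

end


section \<open>Galois groups\<close>

text \<open>Only the monoid laws are checked. Inverses are later carried over from the factor group
  along \<open>\<phi>\<close>, which avoids showing that inverse maps are ring
  homomorphisms.\<close>

lemma monoid_galois_group:
  assumes "ring L" "F \<subseteq> carrier L"
  shows "monoid (galois_group L F)"
proof (rule monoidI)
  interpret ring L by fact
  note d = galois_group_def BijGroup_def
  show "\<sigma> \<otimes>\<^bsub>galois_group L F\<^esub> \<tau> \<in> carrier (galois_group L F)"
    if st: "\<sigma> \<in> carrier (galois_group L F)" "\<tau> \<in> carrier (galois_group L F)" for \<sigma> \<tau>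
  proof -
    have B: "\<sigma> \<in> Bij (carrier L)" "\<tau> \<in> Bij (carrier L)"
      and h: "\<sigma> \<in> ring_hom L L" "\<tau> \<in> ring_hom L L"
      using st by (auto simp: d)
    have "compose (carrier L) \<sigma> \<tau> \<in> ring_hom L L"
      using h by (intro ring_hom_memI)
        (simp_all add: compose_def ring_hom_closed ring_hom_mult ring_hom_add ring_hom_one)
    then show ?thesis
      using st B compose_Bij[OF B] assms(2) by (auto simp: d compose_def)
  qed
  show "\<one>\<^bsub>galois_group L F\<^esub> \<in> carrier (galois_group L F)"
    using assms(2) by (auto simp: d id_Bij intro!: ring_hom_memI)
  show "(\<sigma> \<otimes>\<^bsub>galois_group L F\<^esub> \<tau>) \<otimes>\<^bsub>galois_group L F\<^esub> \<rho>
      = \<sigma> \<otimes>\<^bsub>galois_group L F\<^esub> (\<tau> \<otimes>\<^bsub>galois_group L F\<^esub> \<rho>)"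
    if "\<sigma> \<in> carrier (galois_group L F)" "\<tau> \<in> carrier (galois_group L F)"
      "\<rho> \<in> carrier (galois_group L F)" for \<sigma> \<tau> \<rho>
    using that monoid.m_assoc[OF group.is_monoid[OF group_BijGroup], of \<sigma> "carrier L" \<tau> \<rho>]
    by (auto simp: d)
  show "\<one>\<^bsub>galois_group L F\<^esub> \<otimes>\<^bsub>galois_group L F\<^esub> \<sigma> = \<sigma>"
    if "\<sigma> \<in> carrier (galois_group L F)" for \<sigma>
    using that monoid.l_one[OF group.is_monoid[OF group_BijGroup], of \<sigma> "carrier L"]
    by (auto simp: d)
  show "\<sigma> \<otimes>\<^bsub>galois_group L F\<^esub> \<one>\<^bsub>galois_group L F\<^esub> = \<sigma>"
    if "\<sigma> \<in> carrier (galois_group L F)" for \<sigma>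
    using that monoid.r_one[OF group.is_monoid[OF group_BijGroup], of \<sigma> "carrier L"]
    by (auto simp: d)
qed


section \<open>The descended algebra acting on the module\<close>

text \<open>The setting of the theorem with the pairs unpacked: \<open>given_by_pair\<close> enters
  as bijectivity and additivity of \<open>\<psi>1 \<sigma>\<close> together with the conjugation
  formula.\<close>

locale graded_descent =
  fixes T :: "('t, 'a) monoid_scheme" and K :: "'t set"
    and L :: "('l, 'b) ring_scheme" and F :: "'l set"
    and E :: "('e, 'c) ring_scheme" and \<eta> :: "'l \<Rightarrow> 'e" and EE :: "'t \<Rightarrow> 'e set"
    and \<phi> :: "'t set \<Rightarrow> 'l \<Rightarrow> 'l"
    and V :: "('e, 'v) rmodule" and VV :: "'t \<Rightarrow> 'v set" and U :: "('l \<Rightarrow> 'l) \<Rightarrow> 'v set"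
    and \<psi> :: "('l \<Rightarrow> 'l) \<Rightarrow> ('v \<Rightarrow> 'v) \<Rightarrow> 'v \<Rightarrow> 'v" and \<psi>1 :: "('l \<Rightarrow> 'l) \<Rightarrow> 'v \<Rightarrow> 'v"
    and G :: "('l \<Rightarrow> 'l) monoid"
    and A :: "('v \<Rightarrow> 'v) ring" and AA :: "'t \<Rightarrow> ('v \<Rightarrow> 'v) set"
    and D :: "('v \<Rightarrow> 'v) ring" and DD :: "'t \<Rightarrow> ('v \<Rightarrow> 'v) set"
  assumes E_graded_division: "graded_division_algebra T L \<eta> E EE"
    and E_support: "graded_support T E EE = K"
    and E_center: "ring_center E \<inter> EE \<one>\<^bsub>T\<^esub> = \<eta> ` carrier L"
    and L_galois: "finite_galois_extension F L"
    and G_eq: "G = galois_group L F"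
    and K_normal: "K \<lhd> T"
    and \<phi>_iso: "\<phi> \<in> iso (T Mod K) G"
    and V_graded: "graded_right_module T E EE V VV"
    and V_sum: "internal_direct_sum V (carrier G) U"
    and U_rank_one: "\<sigma> \<in> carrier G \<Longrightarrow>
      rank_one_graded_right_module T E EE (V\<lparr>carrier := U \<sigma>\<rparr>) (\<lambda>t. U \<sigma> \<inter> VV t)"
    and U_support: "\<sigma> \<in> carrier G \<Longrightarrow>
      graded_support T V (\<lambda>t. U \<sigma> \<inter> VV t) \<in> carrier (T Mod K) \<and>
      \<phi> (graded_support T V (\<lambda>t. U \<sigma> \<inter> VV t)) = inv\<^bsub>G\<^esub> \<sigma>"
    and A_eq: "A = end_ring E V" and AA_eq: "AA = end_component T E V VV"
    and \<psi>_descent: "galois_descent_datum T F L (end_scalar \<eta> V) A AA \<psi>"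
    and \<psi>1_bij: "\<sigma> \<in> carrier G \<Longrightarrow> bij_betw (\<psi>1 \<sigma>) (carrier V) (carrier V)"
    and \<psi>1_additive: "\<sigma> \<in> carrier G \<Longrightarrow> additive_on V V (carrier V) (\<psi>1 \<sigma>)"
    and \<psi>_conj: "\<lbrakk>\<sigma> \<in> carrier G; r \<in> carrier A\<rbrakk> \<Longrightarrow>
      \<psi> \<sigma> r = compose (carrier V) (\<psi>1 \<sigma>) (compose (carrier V) r (inv_into (carrier V) (\<psi>1 \<sigma>)))"
    and \<psi>1_one: "v \<in> carrier V \<Longrightarrow> \<psi>1 \<one>\<^bsub>G\<^esub> v = v"
    and \<psi>1_permutes: "\<lbrakk>\<sigma> \<in> carrier G; \<tau> \<in> carrier G\<rbrakk> \<Longrightarrow> \<psi>1 \<sigma> ` U \<tau> = U (\<sigma> \<otimes>\<^bsub>G\<^esub> \<tau>)"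
    and D_eq: "D = descent_form F L A \<psi>" and DD_eq: "DD = (\<lambda>t. AA t \<inter> carrier D)"
begin

sublocale E: graded_division_algebra T L \<eta> E EE by (rule E_graded_division)
sublocale V: graded_right_module T E EE V VV by (rule V_graded)
sublocale K: normal K T by (rule K_normal)

lemma subfield_F: "subfield F L" and F_subset: "F \<subseteq> carrier L"
  using L_galois unfolding finite_galois_extension_def by (auto dest: subfieldE)

sublocale G: group G
proof -
  have "monoid G"
    unfolding G_eq using monoid_galois_group F_subset E.k.ring_axioms by blast
  moreover have "T Mod K \<cong> G" using \<phi>_iso unfolding is_iso_def by blast
  ultimately show "group G" using group.iso_imp_group[OF K.factorgroup_is_group] by blast
qed

section \<open>Supports of the summands as cosets of \<open>K\<close>\<close>

abbreviation summand_support :: "('l \<Rightarrow> 'l) \<Rightarrow> 't set" where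
  "summand_support \<sigma> \<equiv> graded_support T V (\<lambda>t. U \<sigma> \<inter> VV t)"

lemma \<phi>_inj: "inj_on \<phi> (carrier (T Mod K))"
  using \<phi>_iso unfolding iso_def bij_betw_def by auto

lemma \<phi>_hom: "\<phi> \<in> hom (T Mod K) G"
  using \<phi>_iso unfolding iso_def by auto

text \<open>The coset of \<open>g\<close> is labelled by the inverse of its image under
  \<open>\<phi>\<close>, because the support of \<open>U \<sigma>\<close> corresponds to the inverse
  of \<open>\<sigma>\<close>; injectivity of \<open>\<phi>\<close> then identifies the two
  cosets.\<close>

lemma summand_support_cover:
  assumes "g \<in> carrier T"
  obtains \<sigma> where "\<sigma> \<in> carrier G" "g \<in> summand_support \<sigma>"
proof -
  define C where "C = K #>\<^bsub>T\<^esub> g"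
  have C: "C \<in> carrier (T Mod K)"
    unfolding C_def FactGroup_def using assms K.subset E.T.rcosetsI by auto
  have "\<phi> C \<in> carrier G" using \<phi>_hom C unfolding hom_def by auto
  then have \<sigma>: "inv\<^bsub>G\<^esub> \<phi> C \<in> carrier G" "\<phi> (summand_support (inv\<^bsub>G\<^esub> \<phi> C)) = \<phi> C"
    using U_support[of "inv\<^bsub>G\<^esub> \<phi> C"] by auto
  then have "summand_support (inv\<^bsub>G\<^esub> \<phi> C) = C"
    using \<phi>_inj U_support[OF \<sigma>(1)] C by (meson inj_onD)
  moreover have "g \<in> C"
    unfolding C_def using E.T.rcos_self[OF assms K.subgroup_axioms] .
  ultimately show ?thesis using that \<sigma>(1) by blast
qed

text \<open>Cosets that meet are equal, and a coset determines its label through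
  \<open>\<phi>\<close> and inversion.\<close>

lemma summand_support_disjoint:
  assumes "\<sigma> \<in> carrier G" "\<tau> \<in> carrier G" "g \<in> summand_support \<sigma>" "g \<in> summand_support \<tau>"
  shows "\<sigma> = \<tau>"
proof -
  have "summand_support \<sigma> \<in> rcosets\<^bsub>T\<^esub> K" "summand_support \<tau> \<in> rcosets\<^bsub>T\<^esub> K"
    using U_support assms unfolding FactGroup_def by auto
  then have "summand_support \<sigma> = summand_support \<tau>"
    using E.T.rcos_disjoint[OF K.subgroup_axioms] assms(3,4) unfolding pairwise_def disjnt_def by blast
  then have "inv\<^bsub>G\<^esub> \<sigma> = inv\<^bsub>G\<^esub> \<tau>" using U_support assms(1,2) by metis
  then show ?thesis using assms G.inv_inv by metis
qed

text \<open>A homomorphism sends the trivial coset to the identity. Thus the degrees in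
  \<open>K\<close>, the support of \<open>E\<close>, are those of the summand of the
  identity.\<close>

lemma summand_support_one: "summand_support \<one>\<^bsub>G\<^esub> = K"
proof -
  have "\<phi> \<one>\<^bsub>T Mod K\<^esub> = \<one>\<^bsub>G\<^esub>"
    using hom_one[OF \<phi>_hom K.factorgroup_is_group G.is_group] .
  then have "\<phi> (summand_support \<one>\<^bsub>G\<^esub>) = \<phi> \<one>\<^bsub>T Mod K\<^esub>" using U_support[OF G.one_closed] by simp
  moreover have "\<one>\<^bsub>T Mod K\<^esub> \<in> carrier (T Mod K)"
    using K.factorgroup_is_group group.is_monoid monoid.one_closed by blast
  ultimately have "summand_support \<one>\<^bsub>G\<^esub> = \<one>\<^bsub>T Mod K\<^esub>"
    using \<phi>_inj U_support[OF G.one_closed] by (meson inj_onD)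
  then show ?thesis by (simp add: FactGroup_def)
qed

lemma summand_support_carrier: "g \<in> summand_support \<sigma> \<Longrightarrow> g \<in> carrier T"
  by (auto simp: graded_support_def)

section \<open>Homogeneous components versus summands, and homogeneous bases\<close>

lemmas U_sub = V.M.internal_direct_sum_subgroup[OF V_sum]
lemmas VV_sub = V.M.internal_direct_sum_subgroup[OF V.module_grading]
lemmas EE_sub = E.R.internal_direct_sum_subgroup[OF E.grading]

lemma U_ract_closed:
  assumes "\<sigma> \<in> carrier G" "x \<in> U \<sigma>" "d \<in> carrier E"
  shows "x \<bullet>\<^bsub>V\<^esub> d \<in> U \<sigma>"
proof -
  interpret W: rank_one_graded_right_module T E EE "V\<lparr>carrier := U \<sigma>\<rparr>" "\<lambda>t. U \<sigma> \<inter> VV t"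
    using U_rank_one assms(1) .
  show ?thesis using W.ract_closed assms by simp
qed

text \<open>Every vector is a sum of homogeneous elements of the various \<open>U \<tau>\<close>,
  and such an element of degree \<open>h\<close> can be nonzero only for
  \<open>\<tau> = \<sigma>\<close>. So the projection \<open>p\<close> to degree \<open>h\<close>
  takes values in \<open>U \<sigma>\<close>, expressed by \<open>q (p y) = p y\<close> with
  \<open>q\<close> the projection to \<open>U \<sigma>\<close>.\<close>

lemma component_subset_summand:
  assumes \<sigma>: "\<sigma> \<in> carrier G" and h: "h \<in> summand_support \<sigma>"
  shows "VV h \<subseteq> U \<sigma>"
proof -
  have hT: "h \<in> carrier T" using h summand_support_carrier by auto
  obtain p where p: "additive_on V V (carrier V) p" "\<forall>x\<in>VV h. p x = x"
    "\<forall>t\<in>carrier T. \<forall>x\<in>VV t. t \<noteq> h \<longrightarrow> p x = \<zero>\<^bsub>V\<^esub>"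
    using V.M.internal_direct_sum_projection[OF V.module_grading hT] by blast
  obtain q where q: "additive_on V V (carrier V) q" "\<forall>x\<in>carrier V. q x \<in> U \<sigma>"
    "\<forall>x\<in>U \<sigma>. q x = x"
    using V.M.internal_direct_sum_projection[OF V_sum \<sigma>] by blast
  note z = V.M.abelian_group_axioms
  have p0: "p \<zero>\<^bsub>V\<^esub> = \<zero>\<^bsub>V\<^esub>" and q0: "q \<zero>\<^bsub>V\<^esub> = \<zero>\<^bsub>V\<^esub>"
    using additive_on_zero[OF z z p(1)] additive_on_zero[OF z z q(1)] by auto
  have qp_add: "q (p (x \<oplus>\<^bsub>V\<^esub> y)) = p (x \<oplus>\<^bsub>V\<^esub> y)"
    if "x \<in> carrier V" "y \<in> carrier V" "q (p x) = p x" "q (p y) = p y" for x y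
    using that additive_on_add[OF p(1)] additive_on_add[OF q(1)] additive_on_closed[OF p(1)] by simp
  have "q (p y) = p y" if "y \<in> carrier V" for y
    using V_sum that
  proof (induction rule: V.M.internal_direct_sum_induct)
    case zero
    then show ?case using p0 q0 by simp
  next
    case (add x y)
    then show ?case using qp_add by blast
  next
    case (component \<tau> x)
    interpret W: rank_one_graded_right_module T E EE "V\<lparr>carrier := U \<tau>\<rparr>" "\<lambda>t. U \<tau> \<inter> VV t"
      using U_rank_one component(1) .
    \<comment> \<open>A second induction, along the grading of the summand itself, splits
      \<open>x\<close> into vectors that lie in one summand and have one degree.\<close>
    have "x \<in> carrier (V\<lparr>carrier := U \<tau>\<rparr>)" using component by simp
    with W.module_grading show ?case
    proof (induction rule: W.M.internal_direct_sum_induct)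
      case zero
      then show ?case using p0 q0 by simp
    next
      case (add x y)
      then show ?case using qp_add U_sub(1)[OF component(1)] by auto
    next
      case (component t x)
      show ?case
      proof (cases "t = h \<and> x \<noteq> \<zero>\<^bsub>V\<^esub>")
        case True
        then have "h \<in> summand_support \<tau>" using component hT by (auto simp: graded_support_def)
        then have "\<tau> = \<sigma>" using summand_support_disjoint[OF \<open>\<tau> \<in> carrier G\<close> \<sigma> _ h] by blast
        then show ?thesis using True component p(2) q(3) by auto
      next
        case False
        then have "p x = \<zero>\<^bsub>V\<^esub>" using p(3) p0 component by blast
        then show ?thesis using q0 by simp
      qed
    qed
  qed
  then have "q x = x" if "x \<in> VV h" for x using that p(2) VV_sub(1)[OF hT] by (metis subset_eq)
  then show ?thesis using q(2) VV_sub(1)[OF hT] by (metis subset_eq)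
qed

text \<open>The cosets cover \<open>T\<close>, so no component of \<open>V\<close> vanishes; this is
  the source of the full support of \<open>D\<close>.\<close>

lemma component_in_summand:
  assumes "h \<in> carrier T"
  obtains \<sigma> where "\<sigma> \<in> carrier G" "VV h \<subseteq> U \<sigma>" "VV h \<noteq> {\<zero>\<^bsub>V\<^esub>}"
proof -
  obtain \<sigma> where \<sigma>: "\<sigma> \<in> carrier G" "h \<in> summand_support \<sigma>" using summand_support_cover assms by blast
  then have "VV h \<noteq> {\<zero>\<^bsub>V\<^esub>}" using component_subset_summand[OF \<sigma>] unfolding graded_support_def by auto
  then show ?thesis using that \<sigma> component_subset_summand by blast
qed

text \<open>The action on \<open>b\<close> shifts degrees by \<open>k\<close>, so projecting
  \<open>b d\<close> to degree \<open>h\<close> amounts to projecting \<open>d\<close> to the degree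
  \<open>j\<close> with \<open>k j = h\<close>. As \<open>b d\<close> is its own projection,
  injectivity makes \<open>d\<close> its own projection as well.\<close>

lemma homogeneous_coordinate:
  assumes k: "k \<in> carrier T" and h: "h \<in> carrier T" and b: "b \<in> VV k"
    and inj: "inj_on (\<lambda>d. b \<bullet>\<^bsub>V\<^esub> d) (carrier E)"
    and d: "d \<in> carrier E" and bd: "b \<bullet>\<^bsub>V\<^esub> d \<in> VV h"
  shows "d \<in> EE (inv\<^bsub>T\<^esub> k \<otimes>\<^bsub>T\<^esub> h)"
proof -
  define j where "j = inv\<^bsub>T\<^esub> k \<otimes>\<^bsub>T\<^esub> h"
  have j: "j \<in> carrier T" "k \<otimes>\<^bsub>T\<^esub> j = h"
    using k h unfolding j_def by (auto simp: E.T.m_assoc[symmetric])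
  have bV: "b \<in> carrier V" using b VV_sub(1)[OF k] by auto
  obtain p where p: "additive_on V V (carrier V) p"
    "\<forall>x\<in>VV h. p x = x" "\<forall>t\<in>carrier T. \<forall>x\<in>VV t. t \<noteq> h \<longrightarrow> p x = \<zero>\<^bsub>V\<^esub>"
    using V.M.internal_direct_sum_projection[OF V.module_grading h] by blast
  obtain q where q: "additive_on E E (carrier E) q" "\<forall>x\<in>carrier E. q x \<in> EE j"
    "\<forall>x\<in>EE j. q x = x" "\<forall>t\<in>carrier T. \<forall>x\<in>EE t. t \<noteq> j \<longrightarrow> q x = \<zero>\<^bsub>E\<^esub>"
    using E.R.internal_direct_sum_projection[OF E.grading j(1)] by blast
  note z = V.M.abelian_group_axioms E.R.abelian_group_axioms
  have "p (b \<bullet>\<^bsub>V\<^esub> c) = b \<bullet>\<^bsub>V\<^esub> q c" if "c \<in> carrier E" for c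
    using E.grading that
  proof (induction rule: E.R.internal_direct_sum_induct)
    case zero
    then show ?case
      using additive_on_zero[OF z(1,1) p(1)] additive_on_zero[OF z(2,2) q(1)]
      by (simp add: V.ract_zero_right bV)
  next
    case (add x y)
    then show ?case
      using additive_on_add[OF p(1)] additive_on_add[OF q(1)] additive_on_closed[OF q(1)] bV
      by (simp add: V.ract_add_right V.ract_closed)
  next
    case (component t x)
    have bx: "b \<bullet>\<^bsub>V\<^esub> x \<in> VV (k \<otimes>\<^bsub>T\<^esub> t)" using V.component_ract k component b by simp
    show ?case
    proof (cases "t = j")
      case True
      then show ?thesis using bx p(2) q(3) component j(2) by auto
    next
      case False
      then have "k \<otimes>\<^bsub>T\<^esub> t \<noteq> h" using k j component(1) by (metis E.T.l_cancel)
      then show ?thesis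
        using False p(3)[rule_format, OF _ bx] q(4) component k by (simp add: V.ract_zero_right bV)
    qed
  qed
  then have "b \<bullet>\<^bsub>V\<^esub> d = b \<bullet>\<^bsub>V\<^esub> q d" using d bd p(2) by metis
  then have "d = q d" using inj d additive_on_closed[OF q(1) d] unfolding inj_on_def by simp
  then show ?thesis using q(2) d unfolding j_def by metis
qed

text \<open>Rank one gives some homogeneous basis \<open>b\<close>. Then \<open>w = b d\<close> with
  \<open>d\<close> homogeneous and nonzero, hence a unit, and passing from \<open>b\<close> to
  \<open>w\<close> is left multiplication by \<open>d\<close> on coordinates.\<close>

lemma homogeneous_basis_bij:
  assumes \<sigma>: "\<sigma> \<in> carrier G" and h: "h \<in> carrier T"
    and w: "w \<in> VV h" "w \<in> U \<sigma>" "w \<noteq> \<zero>\<^bsub>V\<^esub>"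
  shows "bij_betw (\<lambda>d. w \<bullet>\<^bsub>V\<^esub> d) (carrier E) (U \<sigma>)"
proof -
  obtain k b where k: "k \<in> carrier T" "b \<in> U \<sigma>" "b \<in> VV k"
    and bij: "bij_betw (\<lambda>d. b \<bullet>\<^bsub>V\<^esub> d) (carrier E) (U \<sigma>)"
    using rank_one_graded_right_module.homogeneous_basis[OF U_rank_one[OF \<sigma>]] by auto
  have bV: "b \<in> carrier V" using k VV_sub(1) by auto
  have inj: "inj_on (\<lambda>d. b \<bullet>\<^bsub>V\<^esub> d) (carrier E)" using bij unfolding bij_betw_def by auto
  obtain d where d: "d \<in> carrier E" "w = b \<bullet>\<^bsub>V\<^esub> d"
    using bij w(2) unfolding bij_betw_def by auto
  have "d \<in> EE (inv\<^bsub>T\<^esub> k \<otimes>\<^bsub>T\<^esub> h)" using homogeneous_coordinate[OF k(1) h k(3) inj d(1)] d w by auto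
  moreover have "d \<noteq> \<zero>\<^bsub>E\<^esub>" using d w(3) V.ract_zero_right[OF bV] by auto
  ultimately have du: "d \<in> Units E" using E.homogeneous_invertible[of "inv\<^bsub>T\<^esub> k \<otimes>\<^bsub>T\<^esub> h" d] k(1) h by simp
  have "bij_betw (\<lambda>e. d \<otimes>\<^bsub>E\<^esub> e) (carrier E) (carrier E)"
    by (rule bij_betw_byWitness[where f' = "\<lambda>e. inv\<^bsub>E\<^esub> d \<otimes>\<^bsub>E\<^esub> e"])
      (use du d(1) in \<open>auto simp: E.R.m_assoc[symmetric]\<close>)
  from bij_betw_trans[OF this bij]
  have "bij_betw ((\<lambda>e. b \<bullet>\<^bsub>V\<^esub> e) \<circ> (\<lambda>e. d \<otimes>\<^bsub>E\<^esub> e)) (carrier E) (U \<sigma>)" .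
  moreover have "((\<lambda>e. b \<bullet>\<^bsub>V\<^esub> e) \<circ> (\<lambda>e. d \<otimes>\<^bsub>E\<^esub> e)) e = w \<bullet>\<^bsub>V\<^esub> e" if "e \<in> carrier E" for e
    using that d bV by (simp add: V.ract_assoc)
  ultimately show ?thesis using bij_betw_cong by (metis (no_types, lifting))
qed

section \<open>The descent automorphisms and commutation with \<open>\<psi>1\<close>\<close>

lemma \<psi>_closed:
  assumes "\<sigma> \<in> carrier G"
  shows "r \<in> carrier A \<Longrightarrow> \<psi> \<sigma> r \<in> carrier A"
    and "g \<in> carrier T \<Longrightarrow> r \<in> AA g \<Longrightarrow> \<psi> \<sigma> r \<in> AA g"
    and "\<psi> \<sigma> \<in> ring_hom A A"
    and "c \<in> F \<Longrightarrow> \<psi> \<sigma> (end_scalar \<eta> V c) = end_scalar \<eta> V c"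
proof -
  have "\<psi> \<sigma> \<in> carrier (graded_aut_group T (L\<lparr>carrier := F\<rparr>) (end_scalar \<eta> V) A AA)"
    using assms \<psi>_descent unfolding galois_descent_datum_def hom_def G_eq by auto
  then have "\<psi> \<sigma> \<in> Bij (carrier A)" "\<psi> \<sigma> \<in> ring_hom A A"
    "\<forall>t\<in>carrier T. \<psi> \<sigma> ` AA t = AA t" "\<forall>c\<in>F. \<psi> \<sigma> (end_scalar \<eta> V c) = end_scalar \<eta> V c"
    unfolding graded_aut_group_def by auto
  then show "r \<in> carrier A \<Longrightarrow> \<psi> \<sigma> r \<in> carrier A" "\<psi> \<sigma> \<in> ring_hom A A"
    "g \<in> carrier T \<Longrightarrow> r \<in> AA g \<Longrightarrow> \<psi> \<sigma> r \<in> AA g"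
    "c \<in> F \<Longrightarrow> \<psi> \<sigma> (end_scalar \<eta> V c) = end_scalar \<eta> V c"
    using ring_hom_closed[of "\<psi> \<sigma>" A A] by auto
qed

lemma \<psi>_mult:
  assumes "\<sigma> \<in> carrier G" "\<tau> \<in> carrier G" "r \<in> carrier A"
  shows "\<psi> (\<sigma> \<otimes>\<^bsub>G\<^esub> \<tau>) r = \<psi> \<sigma> (\<psi> \<tau> r)"
proof -
  let ?H = "graded_aut_group T (L\<lparr>carrier := F\<rparr>) (end_scalar \<eta> V) A AA"
  have "\<psi> \<in> hom G ?H" using \<psi>_descent unfolding galois_descent_datum_def G_eq by auto
  then have "\<psi> (\<sigma> \<otimes>\<^bsub>G\<^esub> \<tau>) = \<psi> \<sigma> \<otimes>\<^bsub>?H\<^esub> \<psi> \<tau>" "\<psi> \<sigma> \<in> carrier ?H" "\<psi> \<tau> \<in> carrier ?H"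
    using assms unfolding hom_def by auto
  then show ?thesis using assms(3) by (simp add: graded_aut_group_def BijGroup_def compose_def)
qed

lemma \<psi>1_closed: "\<sigma> \<in> carrier G \<Longrightarrow> x \<in> carrier V \<Longrightarrow> \<psi>1 \<sigma> x \<in> carrier V"
  using \<psi>1_additive additive_on_closed by metis

text \<open>Evaluating the conjugation formula at an image of \<open>\<psi>1 \<sigma>\<close>
  cancels the inverse.\<close>

lemma \<psi>_apply:
  assumes "\<sigma> \<in> carrier G" "r \<in> carrier A" "x \<in> carrier V"
  shows "\<psi> \<sigma> r (\<psi>1 \<sigma> x) = \<psi>1 \<sigma> (r x)"
  using \<psi>_conj[OF assms(1,2)] \<psi>1_closed[OF assms(1,3)] \<psi>1_bij[OF assms(1)] assms(3)
  by (simp add: compose_def bij_betw_def)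

lemma ring_A: "ring A" unfolding A_eq by (rule V.ring_end_ring)

sublocale A: ring A by (rule ring_A)

lemmas A_I = V.end_ringI[folded A_eq]
  and A_D = V.end_ringD[folded A_eq]
  and A_eqI = V.end_ring_eqI[folded A_eq]
  and A_apply = V.end_ring_apply[folded A_eq]

lemma AA_iff:
  "r \<in> AA g \<longleftrightarrow> r \<in> carrier A \<and> (\<forall>h\<in>carrier T. \<forall>x\<in>VV h. r x \<in> VV (g \<otimes>\<^bsub>T\<^esub> h))"
  unfolding AA_eq end_component_def A_eq by auto

text \<open>Being fixed under conjugation means commuting. For the converse direction, surjectivity
  of \<open>\<psi>1 \<sigma>\<close> lets the equality be tested at vectors
  \<open>\<psi>1 \<sigma> x\<close>.\<close>

lemma D_iff:
  "r \<in> carrier D \<longleftrightarrow>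
     r \<in> carrier A \<and> (\<forall>\<sigma>\<in>carrier G. \<forall>x\<in>carrier V. r (\<psi>1 \<sigma> x) = \<psi>1 \<sigma> (r x))"
proof -
  have "\<psi> \<sigma> r = r \<longleftrightarrow> (\<forall>x\<in>carrier V. r (\<psi>1 \<sigma> x) = \<psi>1 \<sigma> (r x))"
    if r: "r \<in> carrier A" and \<sigma>: "\<sigma> \<in> carrier G" for r \<sigma>
  proof
    assume "\<psi> \<sigma> r = r"
    then show "\<forall>x\<in>carrier V. r (\<psi>1 \<sigma> x) = \<psi>1 \<sigma> (r x)" using \<psi>_apply[OF \<sigma> r] by auto
  next
    assume *: "\<forall>x\<in>carrier V. r (\<psi>1 \<sigma> x) = \<psi>1 \<sigma> (r x)"
    show "\<psi> \<sigma> r = r"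
    proof (rule A_eqI[OF \<psi>_closed(1)[OF \<sigma> r] r])
      fix v assume "v \<in> carrier V"
      then obtain x where "x \<in> carrier V" "v = \<psi>1 \<sigma> x"
        using \<psi>1_bij[OF \<sigma>] unfolding bij_betw_def by auto
      then show "\<psi> \<sigma> r v = r v" using * \<psi>_apply[OF \<sigma> r] by auto
    qed
  qed
  then show ?thesis unfolding D_eq descent_form_def G_eq by auto
qed

lemma DD_iff: "r \<in> DD g \<longleftrightarrow> r \<in> AA g \<and> r \<in> carrier D"
  unfolding DD_eq by auto

text \<open>An endomorphism taking \<open>w\<close> to \<open>v\<close> is built on the summand \<open>U \<rho>\<close> containing \<open>w\<close> and
  extended by zero to \<open>r0\<close>. Setting \<open>r = \<psi> (\<tau> \<rho>\<inverse>) r0\<close> on \<open>U \<tau>\<close> gives the formal sum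
  of all \<open>\<psi> \<sigma> r0\<close>; gluing along the direct sum avoids proving that the Galois group is finite.\<close>

lemma homogeneous_transitive:
  assumes h: "h \<in> carrier T" and g: "g \<in> carrier T"
    and w: "w \<in> VV h" "w \<noteq> \<zero>\<^bsub>V\<^esub>" and v: "v \<in> VV (g \<otimes>\<^bsub>T\<^esub> h)"
  obtains r where "r \<in> DD g" "r w = v"
proof -
  obtain \<rho> where \<rho>: "\<rho> \<in> carrier G" "VV h \<subseteq> U \<rho>" using component_in_summand h by blast
  have wU: "w \<in> U \<rho>" using w \<rho> by auto
  have wV: "w \<in> carrier V" using w VV_sub(1)[OF h] by auto
  have vV: "v \<in> carrier V" using v VV_sub(1)[of "g \<otimes>\<^bsub>T\<^esub> h"] g h by auto
  have bij: "bij_betw (\<lambda>d. w \<bullet>\<^bsub>V\<^esub> d) (carrier E) (U \<rho>)"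
    by (rule homogeneous_basis_bij[OF \<rho>(1) h w(1) wU w(2)])
  \<comment> \<open>\<open>c x\<close> is the coordinate of \<open>x\<close> with respect to the
    basis \<open>w\<close> of \<open>U \<rho>\<close>; the map \<open>f\<close> below sends
    \<open>w d\<close> to \<open>v d\<close>.\<close>
  define c where "c = inv_into (carrier E) (\<lambda>d. w \<bullet>\<^bsub>V\<^esub> d)"
  have c: "c x \<in> carrier E" "w \<bullet>\<^bsub>V\<^esub> c x = x" if "x \<in> U \<rho>" for x
    using that bij unfolding c_def bij_betw_def
    by (auto simp: f_inv_into_f[where f = "\<lambda>d. w \<bullet>\<^bsub>V\<^esub> d"] intro: inv_into_into)
  have inj: "inj_on (\<lambda>d. w \<bullet>\<^bsub>V\<^esub> d) (carrier E)" using bij unfolding bij_betw_def by auto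
  have c_eq: "c (w \<bullet>\<^bsub>V\<^esub> d) = d" if "d \<in> carrier E" for d
    unfolding c_def using inj that by (rule inv_into_f_f)
  define f where "f x = v \<bullet>\<^bsub>V\<^esub> c x" for x
  have f_add: "additive_on V V (U \<rho>) f"
  proof (rule additive_onI)
    fix x y assume xy: "x \<in> U \<rho>" "y \<in> U \<rho>"
    have "c (x \<oplus>\<^bsub>V\<^esub> y) = c (w \<bullet>\<^bsub>V\<^esub> (c x \<oplus>\<^bsub>E\<^esub> c y))"
      using c[OF xy(1)] c[OF xy(2)] wV by (simp add: V.ract_add_right)
    then have "c (x \<oplus>\<^bsub>V\<^esub> y) = c x \<oplus>\<^bsub>E\<^esub> c y" using c_eq c(1) xy by simp
    then show "f (x \<oplus>\<^bsub>V\<^esub> y) = f x \<oplus>\<^bsub>V\<^esub> f y"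
      unfolding f_def using c(1) xy vV by (simp add: V.ract_add_right)
  qed (auto simp: f_def vV c(1) V.ract_closed)
  have f_ract: "f (x \<bullet>\<^bsub>V\<^esub> d) = f x \<bullet>\<^bsub>V\<^esub> d" if "x \<in> U \<rho>" "d \<in> carrier E" for x d
  proof -
    have "c (x \<bullet>\<^bsub>V\<^esub> d) = c (w \<bullet>\<^bsub>V\<^esub> (c x \<otimes>\<^bsub>E\<^esub> d))"
      using c[OF that(1)] that(2) wV by (simp add: V.ract_assoc)
    then have "c (x \<bullet>\<^bsub>V\<^esub> d) = c x \<otimes>\<^bsub>E\<^esub> d" using c_eq c(1) that by simp
    then show ?thesis unfolding f_def using c(1) that vV by (simp add: V.ract_assoc)
  qed
  have f_comp: "f x \<in> VV (g \<otimes>\<^bsub>T\<^esub> k)" if x: "x \<in> U \<rho>" "x \<in> VV k" and k: "k \<in> carrier T" for x k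
  proof -
    \<comment> \<open>The coordinate of a vector of degree \<open>k\<close> has degree
      \<open>h^-1 k\<close>, and multiplying \<open>v\<close>, of degree \<open>g h\<close>, by it
      gives degree \<open>g k\<close>.\<close>
    have "c x \<in> EE (inv\<^bsub>T\<^esub> h \<otimes>\<^bsub>T\<^esub> k)"
      by (rule homogeneous_coordinate[OF h k w(1) inj]) (use x c in auto)
    then have "f x \<in> VV ((g \<otimes>\<^bsub>T\<^esub> h) \<otimes>\<^bsub>T\<^esub> (inv\<^bsub>T\<^esub> h \<otimes>\<^bsub>T\<^esub> k))"
      unfolding f_def using V.component_ract v g h k by simp
    moreover have "(g \<otimes>\<^bsub>T\<^esub> h) \<otimes>\<^bsub>T\<^esub> (inv\<^bsub>T\<^esub> h \<otimes>\<^bsub>T\<^esub> k) = g \<otimes>\<^bsub>T\<^esub> k"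
        using g h k by (simp add: E.T.m_assoc) (simp add: E.T.m_assoc[symmetric])
    ultimately show ?thesis by simp
  qed

  \<comment> \<open>Gluing is done twice: for the extension of \<open>f\<close> by zero and for the
    Galois translates. Homogeneity of the glued map can be checked summand by summand because each
    \<open>VV k\<close> lies in a single summand.\<close>
  have extend: "\<exists>r\<in>AA g. \<forall>\<tau>\<in>carrier G. \<forall>x\<in>U \<tau>. r x = q \<tau> x"
    if q_add: "\<And>\<tau>. \<tau> \<in> carrier G \<Longrightarrow> additive_on V V (U \<tau>) (q \<tau>)"
      and q_ract: "\<And>\<tau> x d. \<tau> \<in> carrier G \<Longrightarrow> x \<in> U \<tau> \<Longrightarrow> d \<in> carrier E \<Longrightarrow>
        q \<tau> (x \<bullet>\<^bsub>V\<^esub> d) = q \<tau> x \<bullet>\<^bsub>V\<^esub> d"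
      and q_comp: "\<And>\<tau> x k. \<tau> \<in> carrier G \<Longrightarrow> k \<in> carrier T \<Longrightarrow> x \<in> U \<tau> \<Longrightarrow> x \<in> VV k \<Longrightarrow>
        q \<tau> x \<in> VV (g \<otimes>\<^bsub>T\<^esub> k)"
    for q
  proof -
    obtain r where r: "additive_on V V (carrier V) r"
      "\<And>\<tau> x. \<tau> \<in> carrier G \<Longrightarrow> x \<in> U \<tau> \<Longrightarrow> r x = q \<tau> x"
      using V.M.internal_direct_sum_extend[OF V_sum V.M.abelian_group_axioms q_add] by blast
    have r_ract: "r (x \<bullet>\<^bsub>V\<^esub> d) = r x \<bullet>\<^bsub>V\<^esub> d" if "x \<in> carrier V" and d: "d \<in> carrier E" for x d
      using V_sum that(1)
    proof (induction rule: V.M.internal_direct_sum_induct)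
      case zero
      then show ?case
        using additive_on_zero[OF V.M.abelian_group_axioms V.M.abelian_group_axioms r(1)] d
        by (simp add: V.ract_zero_left)
    next
      case (add x y)
      then show ?case
        using d additive_on_add[OF r(1)] additive_on_closed[OF r(1)]
        by (simp add: V.ract_add_left V.ract_closed)
    next
      case (component \<tau> x)
      then show ?case using d r(2) q_ract U_ract_closed by simp
    qed
    have "restrict r (carrier V) \<in> carrier A"
    proof (rule A_I)
      show "additive_on V V (carrier V) (restrict r (carrier V))"
        using r(1) unfolding additive_on_def by auto
    qed (auto simp: r_ract V.ract_closed)
    moreover have "r x \<in> VV (g \<otimes>\<^bsub>T\<^esub> k)" if k: "k \<in> carrier T" "x \<in> VV k" for k x
    proof -
      obtain \<tau> where "\<tau> \<in> carrier G" "VV k \<subseteq> U \<tau>" using component_in_summand k(1) by blast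
      then show ?thesis using r(2) q_comp k by auto
    qed
    ultimately have "restrict r (carrier V) \<in> AA g"
      unfolding AA_iff using VV_sub(1) by (auto simp: subset_eq)
    then show ?thesis using r(2) U_sub(1) by (intro bexI[of _ "restrict r (carrier V)"]) auto
  qed

  have "\<exists>r\<in>AA g. \<forall>\<tau>\<in>carrier G. \<forall>x\<in>U \<tau>. r x = (if \<tau> = \<rho> then f x else \<zero>\<^bsub>V\<^esub>)"
  proof (rule extend)
    show "additive_on V V (U \<tau>) (\<lambda>x. if \<tau> = \<rho> then f x else \<zero>\<^bsub>V\<^esub>)" if "\<tau> \<in> carrier G" for \<tau>
      using f_add by (cases "\<tau> = \<rho>") (auto simp: additive_on_def)
  qed (use f_ract f_comp VV_sub(2) g in \<open>auto simp: V.ract_zero_left\<close>)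
  then obtain r0 where r0: "r0 \<in> AA g"
    "\<And>\<tau> x. \<tau> \<in> carrier G \<Longrightarrow> x \<in> U \<tau> \<Longrightarrow> r0 x = (if \<tau> = \<rho> then f x else \<zero>\<^bsub>V\<^esub>)" by blast
  have r0A: "r0 \<in> carrier A" using r0(1) AA_iff by auto
  define q where "q \<tau> = \<psi> (\<tau> \<otimes>\<^bsub>G\<^esub> inv\<^bsub>G\<^esub> \<rho>) r0" for \<tau>
  have q: "q \<tau> \<in> AA g" "q \<tau> \<in> carrier A" if "\<tau> \<in> carrier G" for \<tau>
    unfolding q_def using \<psi>_closed that \<rho>(1) g r0(1) r0A by auto
  have "\<exists>r\<in>AA g. \<forall>\<tau>\<in>carrier G. \<forall>x\<in>U \<tau>. r x = q \<tau> x"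
  proof (rule extend)
    fix \<tau> assume \<tau>: "\<tau> \<in> carrier G"
    show "additive_on V V (U \<tau>) (q \<tau>)"
      using A_D(2)[OF q(2)[OF \<tau>]] U_sub(1)[OF \<tau>] unfolding additive_on_def by (auto simp: subset_eq)
    show "q \<tau> (x \<bullet>\<^bsub>V\<^esub> d) = q \<tau> x \<bullet>\<^bsub>V\<^esub> d" if "x \<in> U \<tau>" "d \<in> carrier E" for x d
      using A_D(3)[OF q(2)[OF \<tau>]] U_sub(1)[OF \<tau>] that by auto
    show "q \<tau> x \<in> VV (g \<otimes>\<^bsub>T\<^esub> k)" if "k \<in> carrier T" "x \<in> U \<tau>" "x \<in> VV k" for x k
      using q(1)[OF \<tau>] that unfolding AA_iff by auto
  qed
  then obtain r where r: "r \<in> AA g" "\<And>\<tau> x. \<tau> \<in> carrier G \<Longrightarrow> x \<in> U \<tau> \<Longrightarrow> r x = q \<tau> x" by blast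
  have rA: "r \<in> carrier A" using r AA_iff by auto
  note z = V.M.abelian_group_axioms
  have "r (\<psi>1 \<sigma> x) = \<psi>1 \<sigma> (r x)" if \<sigma>: "\<sigma> \<in> carrier G" and x: "x \<in> carrier V" for \<sigma> x
    using V_sum x
  proof (induction rule: V.M.internal_direct_sum_induct)
    case zero
    then show ?case
      using additive_on_zero[OF z z \<psi>1_additive[OF \<sigma>]] additive_on_zero[OF z z A_D(2)[OF rA]] by simp
  next
    case (add x y)
    then show ?case
      using additive_on_add[OF \<psi>1_additive[OF \<sigma>]] additive_on_add[OF A_D(2)[OF rA]] A_D(4)[OF rA]
        \<psi>1_closed[OF \<sigma>] by simp
  next
    case (component \<tau> x)
    have "\<psi>1 \<sigma> x \<in> U (\<sigma> \<otimes>\<^bsub>G\<^esub> \<tau>)" using \<psi>1_permutes[OF \<sigma> component(1)] component(2) by blast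
    then have "r (\<psi>1 \<sigma> x) = q (\<sigma> \<otimes>\<^bsub>G\<^esub> \<tau>) (\<psi>1 \<sigma> x)" using r(2) \<sigma> component(1) by simp
    \<comment> \<open>Here multiplicativity of \<open>\<psi>\<close> enters; the family
      \<open>\<psi>1\<close> is not assumed to have it.\<close>
    also have "q (\<sigma> \<otimes>\<^bsub>G\<^esub> \<tau>) = \<psi> \<sigma> (q \<tau>)"
      unfolding q_def using \<sigma> component(1) \<rho>(1) r0A \<psi>_mult by (simp add: G.m_assoc)
    also have "\<psi> \<sigma> (q \<tau>) (\<psi>1 \<sigma> x) = \<psi>1 \<sigma> (q \<tau> x)"
      using \<psi>_apply[OF \<sigma> q(2)] component U_sub(1) by blast
    also have "\<dots> = \<psi>1 \<sigma> (r x)" using r(2) component by simp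
    finally show ?case .
  qed
  then have "r \<in> DD g" using r(1) rA unfolding DD_iff D_iff by auto
  moreover have "r w = v"
  proof -
    \<comment> \<open>On \<open>U \<rho>\<close> itself the translating element is the identity, so
      \<open>r\<close> acts there as \<open>r0\<close>.\<close>
    have "r w = \<psi> \<one>\<^bsub>G\<^esub> r0 w" using r(2)[OF \<rho>(1) wU] \<rho>(1) unfolding q_def by simp
    also have "\<dots> = r0 w"
      using \<psi>_apply[OF G.one_closed r0A wV] \<psi>1_one wV A_D(4)[OF r0A] by simp
    also have "\<dots> = v \<bullet>\<^bsub>V\<^esub> c (w \<bullet>\<^bsub>V\<^esub> \<one>\<^bsub>E\<^esub>)"
      using r0(2)[OF \<rho>(1) wU] wV by (simp add: f_def V.ract_one)
    also have "\<dots> = v" using c_eq[OF E.R.one_closed] vV by (simp add: V.ract_one)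
    finally show ?thesis .
  qed
  ultimately show ?thesis using that by blast
qed

text \<open>An element killing \<open>w\<close> kills \<open>w E = U \<rho>\<close>, and commuting
  with \<open>\<psi>1\<close> spreads this to all summands. The vector is arbitrary because
  invertibility will need the criterion at \<open>r base_vector\<close>.\<close>

lemma homogeneous_faithful:
  assumes r: "r \<in> carrier D" and h: "h \<in> carrier T" and w: "w \<in> VV h" "w \<noteq> \<zero>\<^bsub>V\<^esub>" and rw: "r w = \<zero>\<^bsub>V\<^esub>"
  shows "r = \<zero>\<^bsub>A\<^esub>"
proof -
  have rA: "r \<in> carrier A" and comm: "\<And>\<sigma> x. \<sigma> \<in> carrier G \<Longrightarrow> x \<in> carrier V \<Longrightarrow> r (\<psi>1 \<sigma> x) = \<psi>1 \<sigma> (r x)"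
    using r unfolding D_iff by auto
  note z = V.M.abelian_group_axioms
  obtain \<rho> where \<rho>: "\<rho> \<in> carrier G" "VV h \<subseteq> U \<rho>" using component_in_summand h by blast
  have wU: "w \<in> U \<rho>" using w \<rho> by auto
  have wV: "w \<in> carrier V" using w VV_sub(1)[OF h] by auto
  have r\<rho>: "r x = \<zero>\<^bsub>V\<^esub>" if "x \<in> U \<rho>" for x
  proof -
    obtain d where "d \<in> carrier E" "x = w \<bullet>\<^bsub>V\<^esub> d"
      using homogeneous_basis_bij[OF \<rho>(1) h w(1) wU w(2)] \<open>x \<in> U \<rho>\<close> unfolding bij_betw_def by auto
    then show ?thesis using A_D(3)[OF rA wV] rw by (simp add: V.ract_zero_left)
  qed
  have "r x = \<zero>\<^bsub>V\<^esub>" if "x \<in> carrier V" for x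
    using V_sum that
  proof (induction rule: V.M.internal_direct_sum_induct)
    case zero
    then show ?case using additive_on_zero[OF z z A_D(2)[OF rA]] by simp
  next
    case (add x y)
    then show ?case using additive_on_add[OF A_D(2)[OF rA]] by simp
  next
    case (component \<tau> x)
    define \<sigma> where "\<sigma> = \<tau> \<otimes>\<^bsub>G\<^esub> inv\<^bsub>G\<^esub> \<rho>"
    have \<sigma>: "\<sigma> \<in> carrier G" "\<sigma> \<otimes>\<^bsub>G\<^esub> \<rho> = \<tau>"
      using component(1) \<rho>(1) unfolding \<sigma>_def by (auto simp: G.m_assoc)
    obtain y where y: "y \<in> U \<rho>" "x = \<psi>1 \<sigma> y"
      using \<psi>1_permutes[OF \<sigma>(1) \<rho>(1)] component(2) unfolding \<sigma>(2) by blast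
    have "y \<in> carrier V" using y U_sub(1)[OF \<rho>(1)] by auto
    then show ?case
      using comm[OF \<sigma>(1)] y r\<rho> additive_on_zero[OF z z \<psi>1_additive[OF \<sigma>(1)]] by simp
  qed
  then show ?thesis using A_eqI[OF rA A.zero_closed] A_apply(4) by simp
qed

section \<open>The structure of the descended algebra\<close>

lemma D_fields [simp]:
  "\<zero>\<^bsub>D\<^esub> = \<zero>\<^bsub>A\<^esub>" "\<one>\<^bsub>D\<^esub> = \<one>\<^bsub>A\<^esub>" "r \<oplus>\<^bsub>D\<^esub> s = r \<oplus>\<^bsub>A\<^esub> s" "r \<otimes>\<^bsub>D\<^esub> s = r \<otimes>\<^bsub>A\<^esub> s"
  unfolding D_eq descent_form_def by simp_all

lemma D_fixed: "r \<in> carrier D \<longleftrightarrow> r \<in> carrier A \<and> (\<forall>\<sigma>\<in>carrier G. \<psi> \<sigma> r = r)"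
  unfolding D_eq descent_form_def G_eq by simp

lemma D_subring: "subring (carrier D) A"
proof (rule A.subringI)
  have minus: "\<psi> \<sigma> (\<ominus>\<^bsub>A\<^esub> r) = \<ominus>\<^bsub>A\<^esub> \<psi> \<sigma> r" if "\<sigma> \<in> carrier G" "r \<in> carrier A" for \<sigma> r
  proof -
    interpret h: ring_hom_ring A A "\<psi> \<sigma>"
      by (rule ring_hom_ringI2[OF ring_A ring_A \<psi>_closed(3)[OF that(1)]])
    show ?thesis using that(2) by simp
  qed
  show "\<one>\<^bsub>A\<^esub> \<in> carrier D"
    unfolding D_fixed using ring_hom_one[OF \<psi>_closed(3)] by simp
  show "\<ominus>\<^bsub>A\<^esub> r \<in> carrier D" if "r \<in> carrier D" for r
    using that minus unfolding D_fixed by simp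
  show "r \<otimes>\<^bsub>A\<^esub> s \<in> carrier D" "r \<oplus>\<^bsub>A\<^esub> s \<in> carrier D" if "r \<in> carrier D" "s \<in> carrier D" for r s
    using that ring_hom_mult[OF \<psi>_closed(3)] ring_hom_add[OF \<psi>_closed(3)] unfolding D_fixed by simp_all
qed (auto simp: D_fixed)

sublocale D: ring D
proof -
  have "A\<lparr>carrier := carrier D\<rparr> = D" unfolding D_eq descent_form_def by simp
  then show "ring D" using A.subring_is_ring[OF D_subring] by simp
qed

lemma D_A: "r \<in> carrier D \<Longrightarrow> r \<in> carrier A"
  unfolding D_fixed by blast

lemma DD_D: "r \<in> DD g \<Longrightarrow> r \<in> carrier D" and DD_AA: "r \<in> DD g \<Longrightarrow> r \<in> AA g"
  unfolding DD_iff by auto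

lemma DD_apply: "r \<in> DD g \<Longrightarrow> h \<in> carrier T \<Longrightarrow> x \<in> VV h \<Longrightarrow> r x \<in> VV (g \<otimes>\<^bsub>T\<^esub> h)"
  using DD_AA AA_iff by blast

lemma DD_mult:
  assumes g: "g \<in> carrier T" and h: "h \<in> carrier T" and r: "r \<in> DD g" and s: "s \<in> DD h"
  shows "r \<otimes>\<^bsub>A\<^esub> s \<in> DD (g \<otimes>\<^bsub>T\<^esub> h)"
proof -
  have "(r \<otimes>\<^bsub>A\<^esub> s) x \<in> VV ((g \<otimes>\<^bsub>T\<^esub> h) \<otimes>\<^bsub>T\<^esub> k)" if k: "k \<in> carrier T" "x \<in> VV k" for k x
  proof -
    have "r (s x) \<in> VV (g \<otimes>\<^bsub>T\<^esub> (h \<otimes>\<^bsub>T\<^esub> k))"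
      using DD_apply[OF r _ DD_apply[OF s k]] h k by simp
    moreover have "x \<in> carrier V" using VV_sub(1) k by blast
    ultimately show ?thesis using g h k by (simp add: A_apply E.T.m_assoc)
  qed
  then show ?thesis
    using D.m_closed[OF DD_D[OF r] DD_D[OF s]] D_A unfolding DD_iff AA_iff by auto
qed

section \<open>Evaluation at a vector of degree e\<close>

definition base_vector :: 'v where
  "base_vector = (SOME u. u \<in> VV \<one>\<^bsub>T\<^esub> \<and> u \<noteq> \<zero>\<^bsub>V\<^esub>)"

text \<open>The degree e lies in \<open>K\<close>, so the vector belongs to the summand of the
  identity and is a basis of it. Degree e also makes evaluation preserve degrees.\<close>

lemma base_vector:
  shows base_vector_component: "base_vector \<in> VV \<one>\<^bsub>T\<^esub>"
    and base_vector_nonzero: "base_vector \<noteq> \<zero>\<^bsub>V\<^esub>"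
    and base_vector_closed: "base_vector \<in> carrier V"
    and base_vector_bij: "bij_betw (\<lambda>d. base_vector \<bullet>\<^bsub>V\<^esub> d) (carrier E) (U \<one>\<^bsub>G\<^esub>)"
proof -
  have "VV \<one>\<^bsub>T\<^esub> \<noteq> {\<zero>\<^bsub>V\<^esub>}" using component_in_summand[OF E.T.one_closed] by blast
  then have "\<exists>u. u \<in> VV \<one>\<^bsub>T\<^esub> \<and> u \<noteq> \<zero>\<^bsub>V\<^esub>" using VV_sub(2)[OF E.T.one_closed] by blast
  then have *: "base_vector \<in> VV \<one>\<^bsub>T\<^esub> \<and> base_vector \<noteq> \<zero>\<^bsub>V\<^esub>"
    unfolding base_vector_def by (rule someI_ex)
  then show "base_vector \<in> VV \<one>\<^bsub>T\<^esub>" "base_vector \<noteq> \<zero>\<^bsub>V\<^esub>" by auto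
  then show "base_vector \<in> carrier V" using VV_sub(1)[OF E.T.one_closed] by auto
  have "\<one>\<^bsub>T\<^esub> \<in> summand_support \<one>\<^bsub>G\<^esub>" unfolding summand_support_one by (rule K.one_closed)
  then have "VV \<one>\<^bsub>T\<^esub> \<subseteq> U \<one>\<^bsub>G\<^esub>" by (rule component_subset_summand[OF G.one_closed])
  then show "bij_betw (\<lambda>d. base_vector \<bullet>\<^bsub>V\<^esub> d) (carrier E) (U \<one>\<^bsub>G\<^esub>)"
    using homogeneous_basis_bij[OF G.one_closed E.T.one_closed] * by auto
qed

lemma coordinate_component:
  assumes "t \<in> carrier T" "d \<in> carrier E" "base_vector \<bullet>\<^bsub>V\<^esub> d \<in> VV t"
  shows "d \<in> EE t"
  using homogeneous_coordinate[OF E.T.one_closed assms(1) base_vector_component _ assms(2,3)]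
    base_vector_bij assms(1) unfolding bij_betw_def by simp

lemma ract_base_vector_component: "t \<in> carrier T \<Longrightarrow> d \<in> EE t \<Longrightarrow> base_vector \<bullet>\<^bsub>V\<^esub> d \<in> VV t"
  using V.component_ract[OF E.T.one_closed _ base_vector_component] by fastforce

lemma ract_base_vector_inj:
  "d \<in> carrier E \<Longrightarrow> d' \<in> carrier E \<Longrightarrow> base_vector \<bullet>\<^bsub>V\<^esub> d = base_vector \<bullet>\<^bsub>V\<^esub> d' \<Longrightarrow> d = d'"
  using base_vector_bij unfolding bij_betw_def inj_on_def by blast

text \<open>Components with degree in \<open>K\<close> lie in the summand of the identity, which is
  generated by \<open>base_vector\<close>.\<close>

lemma component_coordinate:
  assumes "t \<in> K" "x \<in> VV t"
  shows "\<exists>d\<in>EE t. x = base_vector \<bullet>\<^bsub>V\<^esub> d"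
proof -
  have t: "t \<in> carrier T" using assms(1) K.subset by auto
  have "x \<in> U \<one>\<^bsub>G\<^esub>"
    using component_subset_summand[OF G.one_closed] assms unfolding summand_support_one by auto
  then obtain d where "d \<in> carrier E" "x = base_vector \<bullet>\<^bsub>V\<^esub> d"
    using base_vector_bij unfolding bij_betw_def by auto
  then show ?thesis using coordinate_component[OF t] assms(2) by auto
qed

abbreviation eval_base :: "('v \<Rightarrow> 'v) \<Rightarrow> 'v" where
  "eval_base \<equiv> \<lambda>r. r base_vector"

lemma eval_base_additive: "additive_on D V (carrier D) eval_base"
  by (rule additive_onI) (simp_all add: A_apply base_vector_closed D_A A_D(4))

text \<open>The difference \<open>m\<close> of the two elements kills \<open>base_vector\<close>, so
  \<open>homogeneous_faithful\<close> applies to it.\<close>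

lemma D_eqI:
  assumes r: "r \<in> carrier D" and s: "s \<in> carrier D" and rs: "r base_vector = s base_vector"
  shows "r = s"
proof -
  define m where "m = r \<oplus>\<^bsub>D\<^esub> (\<ominus>\<^bsub>D\<^esub> s)"
  have "r = m \<oplus>\<^bsub>D\<^esub> s" using r s unfolding m_def by (simp only: D.a_assoc D.a_inv_closed D.l_neg D.r_zero)
  moreover have m: "m \<in> carrier D" unfolding m_def using r s by blast
  ultimately have "m base_vector \<oplus>\<^bsub>V\<^esub> s base_vector = s base_vector"
    using rs by (simp add: A_apply base_vector_closed)
  then have "m base_vector = \<zero>\<^bsub>V\<^esub>"
    using A_D(4)[OF D_A[OF m] base_vector_closed] A_D(4)[OF D_A[OF s] base_vector_closed]
      V.M.add.r_cancel_one by blast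
  then have "m = \<zero>\<^bsub>D\<^esub>"
    using homogeneous_faithful[OF m E.T.one_closed base_vector_component base_vector_nonzero] by simp
  with \<open>r = m \<oplus>\<^bsub>D\<^esub> s\<close> show ?thesis using s by (simp only: D.l_zero)
qed

text \<open>Surjectivity onto the component is \<open>homogeneous_transitive\<close> at degree
  e.\<close>

lemma eval_base_DD:
  assumes g: "g \<in> carrier T"
  shows "eval_base ` DD g = VV g"
proof (intro equalityI subsetI)
  fix v assume "v \<in> VV g"
  then have "v \<in> VV (g \<otimes>\<^bsub>T\<^esub> \<one>\<^bsub>T\<^esub>)" using g by simp
  then obtain r where "r \<in> DD g" "r base_vector = v"
    by (rule homogeneous_transitive[OF E.T.one_closed g base_vector_component base_vector_nonzero])
  then show "v \<in> eval_base ` DD g" by blast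
next
  fix v assume "v \<in> eval_base ` DD g"
  then show "v \<in> VV g" using DD_apply[OF _ E.T.one_closed base_vector_component, of _ g] g by auto
qed

lemma eval_base_bij: "bij_betw eval_base (carrier D) (carrier V)"
proof -
  have "v \<in> eval_base ` carrier D" if "v \<in> carrier V" for v
    using V.module_grading that
  proof (induction rule: V.M.internal_direct_sum_induct)
    case zero
    have "\<zero>\<^bsub>D\<^esub> base_vector = \<zero>\<^bsub>V\<^esub>" by (simp add: A_apply base_vector_closed)
    then show ?case by (metis D.zero_closed imageI)
  next
    case (add x y)
    then obtain r s where "r \<in> carrier D" "s \<in> carrier D" "x = r base_vector" "y = s base_vector" by auto
    then have "x \<oplus>\<^bsub>V\<^esub> y = (r \<oplus>\<^bsub>D\<^esub> s) base_vector" "r \<oplus>\<^bsub>D\<^esub> s \<in> carrier D"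
      using D.a_closed[of r s] by (auto simp: A_apply base_vector_closed)
    then show ?case by blast
  next
    case (component t x)
    then show ?case using eval_base_DD DD_D by blast
  qed
  then have "eval_base ` carrier D = carrier V"
    using A_D(4)[OF D_A base_vector_closed] by blast
  moreover have "inj_on eval_base (carrier D)" using D_eqI by (auto intro!: inj_onI)
  ultimately show ?thesis unfolding bij_betw_def by blast
qed

lemma exists_D:
  assumes "v \<in> carrier V"
  obtains r where "r \<in> carrier D" "r base_vector = v"
proof -
  have "v \<in> eval_base ` carrier D" using eval_base_bij assms unfolding bij_betw_def by simp
  then show ?thesis using that by auto
qed

text \<open>Degree can be read off at one vector: some element of \<open>DD g\<close> takes the same
  value at \<open>base_vector\<close>, and equal values force equality in \<open>D\<close>.\<close>

lemma DD_memI: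
  assumes "g \<in> carrier T" "r \<in> carrier D" "r base_vector \<in> VV g"
  shows "r \<in> DD g"
proof -
  have "r base_vector \<in> eval_base ` DD g" using eval_base_DD[OF assms(1)] assms(3) by simp
  then obtain s where "s \<in> DD g" "r base_vector = s base_vector" by auto
  then show ?thesis using D_eqI[OF assms(2) DD_D] by simp
qed

lemma D_grading: "internal_direct_sum D (carrier T) DD"
  by (rule internal_direct_sum_transport[OF D.abelian_group_axioms V.M.abelian_group_axioms
        V.module_grading eval_base_additive eval_base_bij])
    (use DD_D eval_base_DD in auto)

section \<open>Scalars and the graded \<open>F\<close>-algebra structure of \<open>D\<close>\<close>

lemma \<eta>_central:
  assumes "c \<in> carrier L"
  shows "\<eta> c \<in> EE \<one>\<^bsub>T\<^esub>" "\<eta> c \<in> carrier E" "d \<in> carrier E \<Longrightarrow> \<eta> c \<otimes>\<^bsub>E\<^esub> d = d \<otimes>\<^bsub>E\<^esub> \<eta> c"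
proof -
  have "\<eta> c \<in> ring_center E \<inter> EE \<one>\<^bsub>T\<^esub>" unfolding E_center using assms by auto
  then show "\<eta> c \<in> EE \<one>\<^bsub>T\<^esub>" "\<eta> c \<in> carrier E" "d \<in> carrier E \<Longrightarrow> \<eta> c \<otimes>\<^bsub>E\<^esub> d = d \<otimes>\<^bsub>E\<^esub> \<eta> c"
    unfolding ring_center_def by auto
qed

abbreviation scalar :: "'l \<Rightarrow> 'v \<Rightarrow> 'v" where "scalar \<equiv> end_scalar \<eta> V"

lemma scalar_apply: "v \<in> carrier V \<Longrightarrow> scalar c v = v \<bullet>\<^bsub>V\<^esub> \<eta> c"
  by (simp add: end_scalar_def)

lemma scalar_A: "c \<in> carrier L \<Longrightarrow> scalar c \<in> carrier A"
proof (rule A_I)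
  assume c: "c \<in> carrier L"
  show "scalar c \<in> extensional (carrier V)" by (simp add: end_scalar_def)
  show "additive_on V V (carrier V) (scalar c)"
    using \<eta>_central(2)[OF c]
    by (intro additive_onI) (simp_all add: scalar_apply V.ract_closed V.ract_add_left)
  show "scalar c (v \<bullet>\<^bsub>V\<^esub> d) = scalar c v \<bullet>\<^bsub>V\<^esub> d" if "v \<in> carrier V" "d \<in> carrier E" for v d
    using that \<eta>_central[OF c] by (simp add: scalar_apply V.ract_closed flip: V.ract_assoc)
qed

lemma scalar_commute:
  assumes c: "c \<in> carrier L" and r: "r \<in> carrier A"
  shows "scalar c \<otimes>\<^bsub>A\<^esub> r = r \<otimes>\<^bsub>A\<^esub> scalar c"
proof (rule A_eqI)
  show "(scalar c \<otimes>\<^bsub>A\<^esub> r) v = (r \<otimes>\<^bsub>A\<^esub> scalar c) v" if "v \<in> carrier V" for v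
    using that A_D(3,4)[OF r] \<eta>_central(2)[OF c] by (simp add: A_apply scalar_apply)
qed (use scalar_A[OF c] r in auto)

lemma scalar_hom: "scalar \<in> ring_hom L A"
proof (rule ring_hom_memI)
  note h = E.structure_map_hom
  fix c assume c: "c \<in> carrier L"
  show "scalar c \<in> carrier A" by (rule scalar_A[OF c])
  fix c' assume c': "c' \<in> carrier L"
  note e = \<eta>_central(2)[OF c] \<eta>_central(2)[OF c']
  show "scalar (c \<otimes>\<^bsub>L\<^esub> c') = scalar c \<otimes>\<^bsub>A\<^esub> scalar c'"
  proof (rule A_eqI)
    fix v assume "v \<in> carrier V"
    then show "scalar (c \<otimes>\<^bsub>L\<^esub> c') v = (scalar c \<otimes>\<^bsub>A\<^esub> scalar c') v"
      \<comment> \<open>Right actions compose in the opposite order; centrality of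
        \<open>\<eta> c\<close> restores it.\<close>
      using e \<eta>_central(3)[OF c e(2)] ring_hom_mult[OF h c c']
      by (simp add: A_apply scalar_apply V.ract_closed flip: V.ract_assoc)
  qed (use c c' scalar_A in auto)
  show "scalar (c \<oplus>\<^bsub>L\<^esub> c') = scalar c \<oplus>\<^bsub>A\<^esub> scalar c'"
  proof (rule A_eqI)
    fix v assume "v \<in> carrier V"
    then show "scalar (c \<oplus>\<^bsub>L\<^esub> c') v = (scalar c \<oplus>\<^bsub>A\<^esub> scalar c') v"
      using e ring_hom_add[OF h c c'] by (simp add: A_apply scalar_apply V.ract_add_right)
  qed (use c c' scalar_A in auto)
next
  show "scalar \<one>\<^bsub>L\<^esub> = \<one>\<^bsub>A\<^esub>"
    by (rule A_eqI)
      (use scalar_A ring_hom_one[OF E.structure_map_hom] in \<open>auto simp: A_apply scalar_apply V.ract_one\<close>)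
qed

text \<open>The descent automorphisms are \<open>F\<close>-linear, so they fix the scalars from
  \<open>F\<close>.\<close>

lemma scalar_D: "c \<in> F \<Longrightarrow> scalar c \<in> DD \<one>\<^bsub>T\<^esub>"
proof (rule DD_memI[OF E.T.one_closed])
  assume c: "c \<in> F"
  then have cL: "c \<in> carrier L" using F_subset by auto
  show "scalar c \<in> carrier D" unfolding D_fixed using scalar_A[OF cL] \<psi>_closed(4) c by auto
  show "scalar c base_vector \<in> VV \<one>\<^bsub>T\<^esub>"
    using ract_base_vector_component \<eta>_central(1)[OF cL] by (simp add: scalar_apply base_vector_closed)
qed

lemma D_graded_algebra: "graded_algebra T (L\<lparr>carrier := F\<rparr>) scalar D DD"
proof (intro graded_algebra.intro unital_algebra.intro graded_algebra_axioms.intro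
    unital_algebra_axioms.intro)
  show "field (L\<lparr>carrier := F\<rparr>)" by (rule E.k.subfield_iff(2)[OF subfield_F])
  have F: "c \<in> F \<Longrightarrow> c \<in> carrier L" for c using F_subset by auto
  show "scalar \<in> ring_hom (L\<lparr>carrier := F\<rparr>) D"
    using ring_hom_mult[OF scalar_hom F F] ring_hom_add[OF scalar_hom F F] ring_hom_one[OF scalar_hom]
      DD_D[OF scalar_D]
    by (intro ring_hom_memI) simp_all
  show "scalar ` carrier (L\<lparr>carrier := F\<rparr>) \<subseteq> ring_center D"
    using DD_D[OF scalar_D] scalar_commute[OF F D_A] by (auto simp: ring_center_def)
  show "r \<otimes>\<^bsub>D\<^esub> scalar c \<in> DD t"
    if "t \<in> carrier T" "r \<in> DD t" "c \<in> carrier (L\<lparr>carrier := F\<rparr>)" for t r c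
    using DD_mult[OF that(1) E.T.one_closed that(2) scalar_D[of c]] that by simp
  show "r \<otimes>\<^bsub>D\<^esub> s \<in> DD (g \<otimes>\<^bsub>T\<^esub> h)"
    if "g \<in> carrier T" "h \<in> carrier T" "r \<in> DD g" "s \<in> DD h" for g h r s
    using DD_mult[OF that] by simp
qed (rule E.T.is_group D.ring_axioms D_grading)+

section \<open>Invertibility, support and center\<close>

lemma D_homogeneous_invertible:
  assumes g: "g \<in> carrier T" and r: "r \<in> DD g" and nz: "r \<noteq> \<zero>\<^bsub>D\<^esub>"
  shows "r \<in> Units D"
proof -
  note u = base_vector_component base_vector_closed
  have rD: "r \<in> carrier D" using DD_D r by auto
  have w: "r base_vector \<in> VV g" using DD_apply[OF r E.T.one_closed u(1)] g by simp
  have w0: "r base_vector \<noteq> \<zero>\<^bsub>V\<^esub>"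
    using homogeneous_faithful[OF rD E.T.one_closed u(1) base_vector_nonzero] nz by auto
  have "base_vector \<in> VV (inv\<^bsub>T\<^esub> g \<otimes>\<^bsub>T\<^esub> g)" using u(1) g by simp
  \<comment> \<open>Transitivity supplies a candidate inverse: an element of degree
    \<open>g^-1\<close> that takes \<open>r base_vector\<close> back.\<close>
  then obtain s where s: "s \<in> DD (inv\<^bsub>T\<^esub> g)" "s (r base_vector) = base_vector"
    using homogeneous_transitive[OF g E.T.inv_closed[OF g] w w0] by blast
  have sD: "s \<in> carrier D" using DD_D s by auto
  have wV: "r base_vector \<in> carrier V" using VV_sub(1)[OF g] w by auto
  have "s \<otimes>\<^bsub>D\<^esub> r = \<one>\<^bsub>D\<^esub>"
    by (rule D_eqI[OF D.m_closed[OF sD rD] D.one_closed]) (simp add: A_apply u s)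
  moreover have "r \<otimes>\<^bsub>D\<^esub> s = \<one>\<^bsub>D\<^esub>"
  proof -
    \<comment> \<open>The product \<open>r s\<close> is seen to fix \<open>r base_vector\<close>, so
      faithfulness is applied to its difference from the identity at that vector.\<close>
    define m where "m = r \<otimes>\<^bsub>D\<^esub> s \<oplus>\<^bsub>D\<^esub> \<ominus>\<^bsub>D\<^esub> \<one>\<^bsub>D\<^esub>"
    have m: "m \<in> carrier D" "r \<otimes>\<^bsub>D\<^esub> s = m \<oplus>\<^bsub>D\<^esub> \<one>\<^bsub>D\<^esub>"
      unfolding m_def using rD sD D.m_closed[OF rD sD] D.one_closed
      by (auto simp only: D.a_assoc D.a_inv_closed D.l_neg D.r_zero intro!: D.a_closed)
    have "m (r base_vector) \<oplus>\<^bsub>V\<^esub> r base_vector = (r \<otimes>\<^bsub>D\<^esub> s) (r base_vector)"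
      unfolding m(2) using wV by (simp add: A_apply)
    also have "\<dots> = r base_vector" using wV s(2) by (simp add: A_apply)
    finally have "m (r base_vector) = \<zero>\<^bsub>V\<^esub>"
      using A_D(4)[OF D_A[OF m(1)] wV] wV V.M.add.r_cancel_one by blast
    then have "m = \<zero>\<^bsub>D\<^esub>" using homogeneous_faithful[OF m(1) g w w0] by simp
    then show ?thesis using m(2) D.one_closed by (simp only: D.l_zero)
  qed
  ultimately show ?thesis using rD sD unfolding Units_def by blast
qed

lemma D_graded_division: "graded_division_algebra T (L\<lparr>carrier := F\<rparr>) scalar D DD"
  using D_graded_algebra D_homogeneous_invertible
  by (simp add: graded_division_algebra_def graded_division_algebra_axioms_def)

lemma D_support: "graded_support T D DD = carrier T"
proof -
  have "DD t \<noteq> {\<zero>\<^bsub>D\<^esub>}" if t: "t \<in> carrier T" for t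
  proof
    assume "DD t = {\<zero>\<^bsub>D\<^esub>}"
    then have "VV t = {\<zero>\<^bsub>V\<^esub>}"
      using eval_base_DD[OF t] by (simp add: A_apply base_vector_closed)
    then show False using component_in_summand[OF t] by blast
  qed
  then show ?thesis unfolding graded_support_def by auto
qed

lemma E_nontrivial: "\<one>\<^bsub>E\<^esub> \<noteq> \<zero>\<^bsub>E\<^esub>"
  using base_vector_nonzero base_vector_closed V.ract_one V.ract_zero_right by metis

lemma \<eta>_inj: "inj_on \<eta> (carrier L)"
proof -
  interpret h: ring_hom_ring L E \<eta>
    using ring_hom_ringI2[OF E.k.ring_axioms E.R.ring_axioms E.structure_map_hom] .
  show ?thesis using h.img_is_subfield(1)[OF E.k.carrier_is_subfield E_nontrivial] .
qed

lemma D_center: "ring_center D \<inter> DD \<one>\<^bsub>T\<^esub> = scalar ` F"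
proof (intro equalityI subsetI)
  fix z assume "z \<in> scalar ` F"
  then obtain c where "c \<in> F" "z = scalar c" by auto
  moreover from this have "z \<in> ring_center D"
    using D_graded_algebra graded_algebra.axioms(2) unital_algebra.structure_map_central by fastforce
  ultimately show "z \<in> ring_center D \<inter> DD \<one>\<^bsub>T\<^esub>" using scalar_D by auto
next
  fix z assume z: "z \<in> ring_center D \<inter> DD \<one>\<^bsub>T\<^esub>"
  note u = base_vector_closed
  have zD: "z \<in> carrier D" and zA: "z \<in> carrier A"
    and zc: "\<And>r. r \<in> carrier D \<Longrightarrow> z \<otimes>\<^bsub>D\<^esub> r = r \<otimes>\<^bsub>D\<^esub> z"
    using z D_A by (auto simp: ring_center_def)
  \<comment> \<open>Centrality evaluated at \<open>base_vector\<close>. Since every vector is some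
    \<open>r base_vector\<close>, the value of \<open>z\<close> at this one vector determines
    \<open>z\<close>.\<close>
  have swap: "z (r base_vector) = r (z base_vector)" if "r \<in> carrier D" for r
    using fun_cong[OF zc[OF that], of base_vector] u by (simp add: A_apply)
  have "z base_vector \<in> VV \<one>\<^bsub>T\<^esub>" using eval_base_DD[OF E.T.one_closed] z by blast
  then obtain d where d: "d \<in> EE \<one>\<^bsub>T\<^esub>" "z base_vector = base_vector \<bullet>\<^bsub>V\<^esub> d"
    using component_coordinate[OF K.one_closed] by blast
  have dE: "d \<in> carrier E" using d EE_sub(1) by blast
  have "d \<otimes>\<^bsub>E\<^esub> d' = d' \<otimes>\<^bsub>E\<^esub> d" if d': "d' \<in> carrier E" for d'
  proof (rule ract_base_vector_inj)
    \<comment> \<open>Each \<open>d'\<close> is realized at \<open>base_vector\<close> by an element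
      of \<open>D\<close>, so commuting with \<open>D\<close> forces \<open>d\<close> to commute
      with all of \<open>E\<close>.\<close>
    obtain r where r: "r \<in> carrier D" "r base_vector = base_vector \<bullet>\<^bsub>V\<^esub> d'"
      using exists_D V.ract_closed[OF u d'] by blast
    have "base_vector \<bullet>\<^bsub>V\<^esub> (d \<otimes>\<^bsub>E\<^esub> d') = z (r base_vector)"
      using A_D(3)[OF zA u d'] r(2) d(2) dE d' u by (simp add: V.ract_assoc)
    also have "\<dots> = r (z base_vector)" using swap[OF r(1)] .
    also have "\<dots> = base_vector \<bullet>\<^bsub>V\<^esub> (d' \<otimes>\<^bsub>E\<^esub> d)"
      using A_D(3)[OF D_A[OF r(1)] u dE] r(2) d(2) dE d' u by (simp add: V.ract_assoc)
    finally show "base_vector \<bullet>\<^bsub>V\<^esub> (d \<otimes>\<^bsub>E\<^esub> d') = base_vector \<bullet>\<^bsub>V\<^esub> (d' \<otimes>\<^bsub>E\<^esub> d)" .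
  qed (use dE d' in auto)
  then have "d \<in> ring_center E \<inter> EE \<one>\<^bsub>T\<^esub>" using d dE unfolding ring_center_def by auto
  then obtain c where c: "c \<in> carrier L" "d = \<eta> c" unfolding E_center by auto
  have z_eq: "z = scalar c"
  proof (rule A_eqI[OF zA scalar_A[OF c(1)]])
    fix v assume v: "v \<in> carrier V"
    then obtain r where r: "r \<in> carrier D" "r base_vector = v" using exists_D by blast
    have "z v = r (base_vector \<bullet>\<^bsub>V\<^esub> \<eta> c)" using swap[OF r(1)] r(2) d(2) c(2) by simp
    also have "\<dots> = v \<bullet>\<^bsub>V\<^esub> \<eta> c" using A_D(3)[OF D_A[OF r(1)] u] r(2) \<eta>_central(2)[OF c(1)] by simp
    finally show "z v = scalar c v" using v by (simp add: scalar_apply)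
  qed
  have "\<sigma> c = c" if \<sigma>: "\<sigma> \<in> carrier G" for \<sigma>
  proof -
    have \<sigma>c: "\<sigma> c \<in> carrier L" using \<sigma> c(1) unfolding G_eq galois_group_def by (auto intro: ring_hom_closed)
    \<comment> \<open>Semilinearity at the identity shows that \<open>\<psi> \<sigma>\<close> acts
      on scalars as \<open>\<sigma>\<close> acts on \<open>L\<close>; a scalar fixed by all
      \<open>\<psi> \<sigma>\<close> therefore comes from the fixed field, which is
      \<open>F\<close>.\<close>
    have "\<psi> \<sigma> (\<one>\<^bsub>A\<^esub> \<otimes>\<^bsub>A\<^esub> scalar c) = \<psi> \<sigma> \<one>\<^bsub>A\<^esub> \<otimes>\<^bsub>A\<^esub> scalar (\<sigma> c)"
      using \<psi>_descent \<sigma> c(1) unfolding galois_descent_datum_def G_eq by auto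
    then have "\<psi> \<sigma> (scalar c) = scalar (\<sigma> c)"
      using ring_hom_one[OF \<psi>_closed(3)[OF \<sigma>]] scalar_A c(1) \<sigma>c by simp
    moreover have "\<psi> \<sigma> (scalar c) = scalar c" using zD \<sigma> unfolding D_fixed z_eq by auto
    ultimately have "scalar (\<sigma> c) base_vector = scalar c base_vector" by simp
    then have "\<eta> (\<sigma> c) = \<eta> c"
      using ract_base_vector_inj \<eta>_central(2) \<sigma>c c(1) u by (simp add: scalar_apply)
    then show ?thesis using \<eta>_inj \<sigma>c c(1) unfolding inj_on_def by blast
  qed
  then have "c \<in> F" using L_galois c(1) unfolding finite_galois_extension_def G_eq by blast
  then show "z \<in> scalar ` F" using z_eq by blast
qed

section \<open>The isomorphism of \<open>E\<close> with the part of \<open>D\<close> over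
  \<open>K\<close>\<close>

definition transfer :: "'e \<Rightarrow> 'v \<Rightarrow> 'v" where
  "transfer d = inv_into (carrier D) eval_base (base_vector \<bullet>\<^bsub>V\<^esub> d)"

lemma transfer:
  assumes "d \<in> carrier E"
  shows transfer_closed: "transfer d \<in> carrier D"
    and transfer_apply: "transfer d base_vector = base_vector \<bullet>\<^bsub>V\<^esub> d"
proof -
  have "base_vector \<bullet>\<^bsub>V\<^esub> d \<in> eval_base ` carrier D"
    using eval_base_bij V.ract_closed[OF base_vector_closed assms] unfolding bij_betw_def by blast
  then show "transfer d \<in> carrier D" "transfer d base_vector = base_vector \<bullet>\<^bsub>V\<^esub> d"
    unfolding transfer_def
    using inv_into_into[of _ eval_base "carrier D"] f_inv_into_f[of _ eval_base "carrier D"] by auto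
qed

lemma transfer_eqI:
  "r \<in> carrier D \<Longrightarrow> d \<in> carrier E \<Longrightarrow> r base_vector = base_vector \<bullet>\<^bsub>V\<^esub> d \<Longrightarrow> transfer d = r"
  using D_eqI[OF transfer_closed] transfer_apply by simp

text \<open>Order is preserved by \<open>E\<close>-linearity: if \<open>r u = u d\<close> and
  \<open>s u = u d'\<close>, then \<open>r (s u) = r (u d') = (r u) d' = u (d d')\<close>.\<close>

lemma transfer_hom: "transfer \<in> ring_hom E D"
proof (rule ring_hom_memI)
  note u = base_vector_closed
  fix d assume d: "d \<in> carrier E"
  show "transfer d \<in> carrier D" by (rule transfer_closed[OF d])
  fix d' assume d': "d' \<in> carrier E"
  show "transfer (d \<otimes>\<^bsub>E\<^esub> d') = transfer d \<otimes>\<^bsub>D\<^esub> transfer d'"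
    using transfer_eqI[OF D.m_closed[OF transfer_closed[OF d] transfer_closed[OF d']], of "d \<otimes>\<^bsub>E\<^esub> d'"]
      A_D(3)[OF D_A[OF transfer_closed[OF d]] u d'] d d' u
    by (simp add: A_apply transfer_apply V.ract_assoc)
  show "transfer (d \<oplus>\<^bsub>E\<^esub> d') = transfer d \<oplus>\<^bsub>D\<^esub> transfer d'"
    using transfer_eqI[OF D.a_closed[OF transfer_closed[OF d] transfer_closed[OF d']], of "d \<oplus>\<^bsub>E\<^esub> d'"] d d' u
    by (simp add: A_apply transfer_apply V.ract_add_right)
next
  show "transfer \<one>\<^bsub>E\<^esub> = \<one>\<^bsub>D\<^esub>"
    using transfer_eqI[OF D.one_closed E.R.one_closed] base_vector_closed by (simp add: A_apply V.ract_one)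
qed

lemma transfer_inj: "inj_on transfer (carrier E)"
  using ract_base_vector_inj transfer_apply by (metis inj_onI)

lemma transfer_component:
  assumes "t \<in> K"
  shows "transfer ` EE t = DD t"
proof -
  have t: "t \<in> carrier T" using assms K.subset by auto
  have E: "d \<in> EE t \<Longrightarrow> d \<in> carrier E" for d using EE_sub(1)[OF t] by auto
  show ?thesis
  proof (intro equalityI subsetI)
    fix r assume "r \<in> transfer ` EE t"
    then show "r \<in> DD t"
      using DD_memI[OF t transfer_closed[OF E]] transfer_apply[OF E] ract_base_vector_component[OF t] by auto
  next
    fix r assume r: "r \<in> DD t"
    then have "r base_vector \<in> VV t" using eval_base_DD[OF t] by blast
    then obtain d where d: "d \<in> EE t" "r base_vector = base_vector \<bullet>\<^bsub>V\<^esub> d"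
      using component_coordinate[OF assms] by blast
    then have "transfer d = r" using transfer_eqI[OF DD_D[OF r] E] by blast
    then show "r \<in> transfer ` EE t" using d by blast
  qed
qed

text \<open>For \<open>c\<close> in \<open>F\<close> both elements lie in \<open>D\<close> and agree
  at \<open>base_vector\<close>.\<close>

lemma transfer_scalar: "c \<in> F \<Longrightarrow> transfer (\<eta> c) = scalar c"
  using transfer_eqI[OF DD_D[OF scalar_D]] \<eta>_central(2) F_subset base_vector_closed
  by (auto simp: scalar_apply)

text \<open>\<open>transfer\<close> matches components degree by degree over \<open>K\<close>, and
  both sides consist of finite sums of such components because \<open>E\<close> is supported on
  \<open>K\<close>.\<close>

lemma transfer_image: "transfer ` carrier E = partial_sum D DD K"
proof (intro equalityI subsetI)
  have hom: "additive_on E D (carrier E) transfer"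
    using ring_hom_closed[OF transfer_hom] ring_hom_add[OF transfer_hom] by (intro additive_onI) auto
  note z = E.R.abelian_group_axioms D.abelian_group_axioms
  have t0: "transfer \<zero>\<^bsub>E\<^esub> = \<zero>\<^bsub>D\<^esub>" using additive_on_zero[OF z hom] by simp
  {
    fix r assume "r \<in> transfer ` carrier E"
    then obtain d where d: "d \<in> carrier E" "r = transfer d" by auto
    then obtain f where f: "f \<in> finsupp_families E (carrier T) EE" "d = family_sum E (carrier T) f"
      using E.grading unfolding internal_direct_sum_def bij_betw_def by blast
    note fE = E.R.finsupp_families_closed[OF E.grading f(1)]
    define S where "S = {t \<in> carrier T. f t \<noteq> \<zero>\<^bsub>E\<^esub>}"
    have S: "finite S" using f(1) unfolding S_def finsupp_families_def by auto
    \<comment> \<open>A nonzero term of \<open>f\<close> witnesses a nonzero component of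
      \<open>E\<close>, so its degree lies in the support.\<close>
    have SK: "S \<subseteq> K" unfolding S_def E_support[symmetric] graded_support_def using fE(1) by blast
    define g where "g = (\<lambda>t\<in>K. transfer (f t))"
    have gD: "g t \<in> DD t" "g t \<in> carrier D" if "t \<in> K" for t
    proof -
      have "f t \<in> EE t" using that fE(1) K.subset by auto
      then show "g t \<in> DD t" using that transfer_component[OF that] unfolding g_def by auto
      then show "g t \<in> carrier D" by (rule DD_D)
    qed
    have g_supp: "{t \<in> K. g t \<noteq> \<zero>\<^bsub>D\<^esub>} \<subseteq> S"
      using t0 K.subset unfolding g_def S_def by auto
    have "g \<in> (\<Pi>\<^sub>E t\<in>K. DD t)" using gD(1) unfolding g_def by auto
    then have "g \<in> finsupp_families D K DD"
      unfolding finsupp_families_def using finite_subset[OF g_supp S] by simp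
    moreover have "family_sum D K g = r"
    proof -
      have "family_sum D K g = finsum D g S"
        using SK S g_supp gD by (intro D.family_sum_superset) auto
      also have "\<dots> = finsum D (\<lambda>t. transfer (f t)) S"
        using SK gD by (intro D.finsum_cong') (auto simp: g_def)
      also have "\<dots> = transfer (finsum E f S)"
        using fE(2) S by (intro additive_on_finsum[OF z hom, symmetric]) (auto simp: S_def)
      finally show ?thesis using d f unfolding family_sum_def S_def by simp
    qed
    ultimately show "r \<in> partial_sum D DD K" unfolding partial_sum_def by blast
  }
  {
    fix r assume "r \<in> partial_sum D DD K"
    then obtain g where g: "g \<in> finsupp_families D K DD" "r = family_sum D K g"
      unfolding partial_sum_def by auto
    define S where "S = {t \<in> K. g t \<noteq> \<zero>\<^bsub>D\<^esub>}"
    have S: "finite S" using g(1) unfolding S_def finsupp_families_def by auto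
    have "\<exists>d. d \<in> EE t \<and> transfer d = g t" if "t \<in> S" for t
    proof -
      have t: "t \<in> K" using that unfolding S_def by auto
      then have "g t \<in> DD t" using g(1) unfolding finsupp_families_def by auto
      then have "g t \<in> transfer ` EE t" using transfer_component[OF t] by simp
      then show ?thesis by auto
    qed
    then obtain f where f: "\<And>t. t \<in> S \<Longrightarrow> f t \<in> EE t" "\<And>t. t \<in> S \<Longrightarrow> transfer (f t) = g t" by metis
    have fE: "f \<in> S \<rightarrow> carrier E" using f(1) EE_sub(1) K.subset unfolding S_def by blast
    have "r = finsum D g S" using g(2) unfolding family_sum_def S_def .
    also have "\<dots> = finsum D (\<lambda>t. transfer (f t)) S"
    proof (rule D.finsum_cong'[OF refl])
      show "(\<lambda>t. transfer (f t)) \<in> S \<rightarrow> carrier D" using fE transfer_closed by auto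
    qed (simp add: f(2))
    also have "\<dots> = transfer (finsum E f S)"
      by (rule additive_on_finsum[OF z hom S fE, symmetric])
    finally show "r \<in> transfer ` carrier E" using fE by auto
  }
qed

lemma transfer_iso: "transfer \<in> ring_iso E (D\<lparr>carrier := partial_sum D DD K\<rparr>)"
  using transfer_hom transfer_inj transfer_image
  by (auto simp: ring_iso_def ring_hom_def bij_betw_def)

section \<open>The copy of \<open>L\<close> in the center of the component of degree e\<close>

lemma ring_D_one: "ring (D\<lparr>carrier := DD \<one>\<^bsub>T\<^esub>\<rparr>)"
proof (rule D.subring_is_ring, rule D.subringI)
  interpret B: additive_subgroup "DD \<one>\<^bsub>T\<^esub>" D
    using D_grading unfolding internal_direct_sum_def by simp
  show "\<one>\<^bsub>D\<^esub> \<in> DD \<one>\<^bsub>T\<^esub>"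
    using DD_memI[OF E.T.one_closed D.one_closed] base_vector_component base_vector_closed
    by (simp add: A_apply)
  show "r \<otimes>\<^bsub>D\<^esub> s \<in> DD \<one>\<^bsub>T\<^esub>" if "r \<in> DD \<one>\<^bsub>T\<^esub>" "s \<in> DD \<one>\<^bsub>T\<^esub>" for r s
    using DD_mult[OF _ _ that] by simp
  show "\<ominus>\<^bsub>D\<^esub> r \<in> DD \<one>\<^bsub>T\<^esub>" if "r \<in> DD \<one>\<^bsub>T\<^esub>" for r using B.a_inv_closed[OF that] .
  show "r \<oplus>\<^bsub>D\<^esub> s \<in> DD \<one>\<^bsub>T\<^esub>" if "r \<in> DD \<one>\<^bsub>T\<^esub>" "s \<in> DD \<one>\<^bsub>T\<^esub>" for r s using B.a_closed[OF that] .
qed (use DD_D in blast)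

text \<open>The copy of \<open>L\<close> is formed by \<open>transfer\<close> after
  \<open>\<eta>\<close>, since \<open>scalar c\<close> lies in \<open>D\<close> only for
  \<open>c\<close> in \<open>F\<close>. It is central in degree e because that component is the
  image of \<open>EE\<close> at e, and \<open>\<eta> c\<close> is central in
  \<open>E\<close>.\<close>

lemma field_embedding:
  defines "S \<equiv> (\<lambda>c. transfer (\<eta> c)) ` carrier L"
  shows "S \<subseteq> ring_center (D\<lparr>carrier := DD \<one>\<^bsub>T\<^esub>\<rparr>)"
    and "subfield S (D\<lparr>carrier := DD \<one>\<^bsub>T\<^esub>\<rparr>)"
    and "(\<lambda>c. transfer (\<eta> c)) \<in> ring_iso L (D\<lparr>carrier := S\<rparr>)"
proof -
  let ?D1 = "D\<lparr>carrier := DD \<one>\<^bsub>T\<^esub>\<rparr>" and ?\<theta> = "\<lambda>c. transfer (\<eta> c)"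
  have \<theta>_DD: "?\<theta> c \<in> DD \<one>\<^bsub>T\<^esub>" if "c \<in> carrier L" for c
    using transfer_component[OF K.one_closed] \<eta>_central(1)[OF that] by blast
  have "?\<theta> \<in> ring_hom L D"
    using ring_hom_trans[OF E.structure_map_hom transfer_hom] by (simp add: comp_def)
  then have hom: "?\<theta> \<in> ring_hom L ?D1"
    using \<theta>_DD by (auto simp: ring_hom_def)
  interpret h: ring_hom_ring L ?D1 ?\<theta>
    by (rule ring_hom_ringI2[OF E.k.ring_axioms ring_D_one hom])
  have "\<one>\<^bsub>A\<^esub> \<noteq> \<zero>\<^bsub>A\<^esub>"
    using base_vector_nonzero A_apply(3,4)[OF base_vector_closed] by metis
  then have one: "\<one>\<^bsub>?D1\<^esub> \<noteq> \<zero>\<^bsub>?D1\<^esub>" by simp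
  note img = h.img_is_subfield[OF E.k.carrier_is_subfield one]
  show "subfield S ?D1" unfolding S_def by (rule img(2))
  show "?\<theta> \<in> ring_iso L (D\<lparr>carrier := S\<rparr>)"
    using hom img(1) unfolding S_def by (auto simp: ring_iso_def ring_hom_def bij_betw_def)
  show "S \<subseteq> ring_center ?D1"
  proof
    fix s assume "s \<in> S"
    then obtain c where c: "c \<in> carrier L" "s = ?\<theta> c" unfolding S_def by auto
    have "s \<otimes>\<^bsub>D\<^esub> r = r \<otimes>\<^bsub>D\<^esub> s" if "r \<in> DD \<one>\<^bsub>T\<^esub>" for r
    proof -
      have "r \<in> transfer ` EE \<one>\<^bsub>T\<^esub>" using that transfer_component[OF K.one_closed] by simp
      then obtain d where d: "d \<in> EE \<one>\<^bsub>T\<^esub>" "r = transfer d" by auto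
      have dE: "d \<in> carrier E" using d(1) EE_sub(1) by blast
      show ?thesis
        unfolding c(2) d(2) using \<eta>_central(2,3)[OF c(1)] dE ring_hom_mult[OF transfer_hom] by metis
    qed
    then show "s \<in> ring_center ?D1" using \<theta>_DD c unfolding ring_center_def by auto
  qed
qed

end

theorem theorem2p4:
  fixes T :: "('t, 'a) monoid_scheme" and K :: "'t set"
    and L :: "('l, 'b) ring_scheme" and F :: "'l set"
    and E :: "('e, 'c) ring_scheme" and \<eta> :: "'l \<Rightarrow> 'e" and EE :: "'t \<Rightarrow> 'e set"
    and \<phi> :: "'t set \<Rightarrow> 'l \<Rightarrow> 'l"
    and V :: "('e, 'v) rmodule" and VV :: "'t \<Rightarrow> 'v set" and U :: "('l \<Rightarrow> 'l) \<Rightarrow> 'v set"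
    and \<psi> :: "('l \<Rightarrow> 'l) \<Rightarrow> ('v \<Rightarrow> 'v) \<Rightarrow> 'v \<Rightarrow> 'v"
    and \<psi>0 :: "('l \<Rightarrow> 'l) \<Rightarrow> 'e \<Rightarrow> 'e" and \<psi>1 :: "('l \<Rightarrow> 'l) \<Rightarrow> 'v \<Rightarrow> 'v"
    and G :: "('l \<Rightarrow> 'l) monoid"
    and A :: "('v \<Rightarrow> 'v) ring" and AA :: "'t \<Rightarrow> ('v \<Rightarrow> 'v) set"
    and D :: "('v \<Rightarrow> 'v) ring" and DD :: "'t \<Rightarrow> ('v \<Rightarrow> 'v) set"
  assumes E_graded_division: "graded_division_algebra T L \<eta> E EE"
    and E_finite_dimensional: "ring.finite_dimension E (\<eta> ` carrier L) (carrier E)"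
    and E_support: "graded_support T E EE = K"
    and E_center: "ring_center E \<inter> EE \<one>\<^bsub>T\<^esub> = \<eta> ` carrier L"
    and L_galois: "finite_galois_extension F L"
    and G_eq: "G = galois_group L F"
    and K_normal: "K \<lhd> T"
    and \<phi>_iso: "\<phi> \<in> iso (T Mod K) G"
    and V_graded: "graded_right_module T E EE V VV"
    and V_sum: "internal_direct_sum V (carrier G) U"
    and U_rank_one: "\<forall>\<sigma>\<in>carrier G.
      rank_one_graded_right_module T E EE (V\<lparr>carrier := U \<sigma>\<rparr>) (\<lambda>t. U \<sigma> \<inter> VV t)"
    and U_one_from_each_class: "\<forall>(W :: ('e, 'v) rmodule) WW.
      rank_one_graded_right_module T E EE W WW \<longrightarrow>
      (\<exists>!\<sigma>. \<sigma> \<in> carrier G \<and>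
         graded_module_isomorphic T E W WW (V\<lparr>carrier := U \<sigma>\<rparr>) (\<lambda>t. U \<sigma> \<inter> VV t))"
    and U_support: "\<forall>\<sigma>\<in>carrier G.
      graded_support T V (\<lambda>t. U \<sigma> \<inter> VV t) \<in> carrier (T Mod K) \<and>
      \<phi> (graded_support T V (\<lambda>t. U \<sigma> \<inter> VV t)) = inv\<^bsub>G\<^esub> \<sigma>"
    and A_eq: "A = end_ring E V" and AA_eq: "AA = end_component T E V VV"
    and \<psi>_descent: "galois_descent_datum T F L (end_scalar \<eta> V) A AA \<psi>"
    and \<psi>_pairs: "\<forall>\<sigma>\<in>carrier G.
      given_by_pair T K (L\<lparr>carrier := F\<rparr>) \<eta> E EE V VV (\<psi> \<sigma>) (\<psi>0 \<sigma>) (\<psi>1 \<sigma>)"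
    and \<psi>0_one: "\<forall>d\<in>carrier E. \<psi>0 \<one>\<^bsub>G\<^esub> d = d"
    and \<psi>1_one: "\<forall>v\<in>carrier V. \<psi>1 \<one>\<^bsub>G\<^esub> v = v"
    and \<psi>1_permutes: "\<forall>\<sigma>\<in>carrier G. \<forall>\<tau>\<in>carrier G. \<psi>1 \<sigma> ` U \<tau> = U (\<sigma> \<otimes>\<^bsub>G\<^esub> \<tau>)"
    and D_eq: "D = descent_form F L A \<psi>" and DD_eq: "DD = (\<lambda>t. AA t \<inter> carrier D)"
  shows "graded_division_algebra T (L\<lparr>carrier := F\<rparr>) (end_scalar \<eta> V) D DD \<and>
    graded_support T D DD = carrier T \<and>
    ring_center D \<inter> DD \<one>\<^bsub>T\<^esub> = end_scalar \<eta> V ` F \<and>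
    (\<exists>S \<theta>. S \<subseteq> ring_center (D\<lparr>carrier := DD \<one>\<^bsub>T\<^esub>\<rparr>) \<and>
       subfield S (D\<lparr>carrier := DD \<one>\<^bsub>T\<^esub>\<rparr>) \<and>
       \<theta> \<in> ring_iso L (D\<lparr>carrier := S\<rparr>) \<and>
       (\<forall>c\<in>F. \<theta> c = end_scalar \<eta> V c)) \<and>
    (\<exists>\<Phi>. \<Phi> \<in> ring_iso E (D\<lparr>carrier := partial_sum D DD K\<rparr>) \<and>
       (\<forall>c\<in>F. \<Phi> (\<eta> c) = end_scalar \<eta> V c) \<and>
       (\<forall>t\<in>K. \<Phi> ` EE t = DD t))"
proof -
  interpret graded_descent T K L F E \<eta> EE \<phi> V VV U \<psi> \<psi>1 G A AA D DD
  proof (rule graded_descent.intro)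
    fix \<sigma> assume \<sigma>: "\<sigma> \<in> carrier G"
    \<comment> \<open>The required facts about \<open>\<psi>1 \<sigma>\<close> do not mention the
      degree shift, so they can be taken out of the existential in
      \<open>given_by_pair\<close>.\<close>
    note pair = \<psi>_pairs[rule_format, OF \<sigma>, unfolded given_by_pair_def]
    show "bij_betw (\<psi>1 \<sigma>) (carrier V) (carrier V)" using pair by (elim conjE bexE)
    then have "\<psi>1 \<sigma> v \<in> carrier V" if "v \<in> carrier V" for v
      using that bij_betwE by metis
    then show "additive_on V V (carrier V) (\<psi>1 \<sigma>)"
      using pair by (elim conjE bexE) (rule additive_onI; simp)
    show "\<psi> \<sigma> r = compose (carrier V) (\<psi>1 \<sigma>) (compose (carrier V) r (inv_into (carrier V) (\<psi>1 \<sigma>)))"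
      if "r \<in> carrier A" for r
      using pair[THEN conjunct2, rule_format, of r] that unfolding A_eq by simp
  qed (fact E_graded_division E_support E_center L_galois G_eq K_normal \<phi>_iso V_graded V_sum
      U_rank_one[rule_format] U_support[rule_format] A_eq AA_eq \<psi>_descent
      \<psi>1_one[rule_format] \<psi>1_permutes[rule_format] D_eq DD_eq)+
  show ?thesis
  proof (intro conjI exI ballI)
    show "transfer ` EE t = DD t" if "t \<in> K" for t by (rule transfer_component[OF that])
    show "transfer (\<eta> c) = end_scalar \<eta> V c" if "c \<in> F" for c by (rule transfer_scalar[OF that])
    show "transfer (\<eta> c) = end_scalar \<eta> V c" if "c \<in> F" for c by (rule transfer_scalar[OF that])
  qed (fact D_graded_division D_support D_center field_embedding transfer_iso)+
qed

end
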